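(* Let $\mathcal{M}$ be a $C^*$-algebra, let $\mathcal{H}$ be a Hilbert space, and let $\varphi:\mathcal{M}\rightarrow \mathcal{B}(\mathcal{H})$ be a real completely bounded map. Given two extremal Wittstock decompositions $$\varphi = \varphi^+-\varphi^- = \phi^+-\phi^-,$$ we have $$\operatorname{supp} \varphi^+ = \operatorname{supp} \phi^+ \quad\text{and}\quad \operatorname{supp} \varphi^- = \operatorname{supp} \phi^-.$$
   Context: For a linear map $\varphi$ between $C^*$-algebras, $\varphi^{(n)}([m_{ij}])=[\varphi(m_{ij})]$ is the entrywise map on $n\times n$ matrices. $\varphi$ is completely bounded if $\sup_n\|\varphi^{(n)}\|<\infty$, completely positive if every $\varphi^{(n)}$ takes positive semidefinite elements to positive semidefinite elements, and real if $\varphi(H)^*=\varphi(H^* )$ for all $H$. Wittstock decompositions: a Wittstock decomposition of a real completely bounded map $\varphi:\mathcal{M}\to\mathcal{B}(\mathcal{H})$ is an expression $\varphi=\varphi^+-\varphi^-$ with $\varphi^\pm:\mathcal{M}\to\mathcal{B}(\mathcal{H})$ completely positive. It is extremal if there is no nonzero completely positive $\delta:\mathcal{M}\to\mathcal{B}(\mathcal{H})$ such that $\varphi^+-\delta$ and $\varphi^--\delta$ are both completely positive. Representations: representations are $*$-representations on Hilbert spaces. Two representations are equivalent if they are unitarily similar. $\pi_1$ is a subrepresentation of $\pi_2$ if $\pi_2$ is equivalent to a representation of the form $\pi_1\oplus\pi_3$. $\pi_1$ and $\pi_2$ are totally orthogonal, $\pi_1\perp\pi_2$, if no nonzero subrepresentation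 of $\pi_1$ is equivalent to a subrepresentation of $\pi_2$. Supports: $\operatorname{supp}\pi_1\subseteq\operatorname{supp}\pi_2$ means that there is no nonzero subrepresentation of $\pi_1$ which is totally orthogonal to $\pi_2$; $\operatorname{supp}\pi_1=\operatorname{supp}\pi_2$ means that both inclusions hold. For a completely positive map $\varphi:\mathcal{M}\to\mathcal{B}(\mathcal{H})$, $\operatorname{supp}\varphi$ is the support of the representation $\pi$ in its minimal Stinespring factorization $\varphi(H)=V^*\pi(H)V$, where $\pi:\mathcal{M}\to\mathcal{B}(\mathcal{L})$ is a representation, $V:\mathcal{H}\to\mathcal{L}$ is bounded, and $\pi(\mathcal{M})V\mathcal{H}$ has dense span in $\mathcal{L}$. *)

theory Defs
  imports "HOL-Analysis.Analysis" "Jordan_Normal_Form.Matrix"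
begin

class complex_vector = real_vector +
  fixes scaleC :: "complex \<Rightarrow> 'a \<Rightarrow> 'a" (infixr "*\<^sub>C" 75)
  assumes scaleC_add_right: "c *\<^sub>C (x + y) = c *\<^sub>C x + c *\<^sub>C y"
    and scaleC_add_left: "(c + d) *\<^sub>C x = c *\<^sub>C x + d *\<^sub>C x"
    and scaleC_scaleC: "c *\<^sub>C d *\<^sub>C x = (c * d) *\<^sub>C x"
    and scaleC_of_real: "complex_of_real r *\<^sub>C x = r *\<^sub>R x"

lemma scaleC_one: "1 *\<^sub>C (x::'a::complex_vector) = x"
  using scaleC_of_real[of 1 x] by simp

global_interpretation complex_vector: vector_space "scaleC :: complex \<Rightarrow> 'a \<Rightarrow> 'a::complex_vector"
  defines csubspace = complex_vector.subspace
    and cspan = complex_vector.span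
  by standard (simp_all add: scaleC_add_right scaleC_add_left scaleC_scaleC scaleC_one)

abbreviation clinear :: "('a::complex_vector \<Rightarrow> 'b::complex_vector) \<Rightarrow> bool"
  where "clinear \<equiv> Vector_Spaces.linear scaleC scaleC"

lemma clinear_iff:
  "clinear f \<longleftrightarrow> (\<forall>x y. f (x + y) = f x + f y) \<and> (\<forall>c x. f (c *\<^sub>C x) = c *\<^sub>C f x)"
  by (simp add: Vector_Spaces.linear_iff complex_vector.vector_space_axioms)

class complex_normed_vector = complex_vector + real_normed_vector +
  assumes norm_scaleC: "norm (c *\<^sub>C x) = cmod c * norm x"

text \<open>
  The inner product is conjugate-linear in its first argument.
\<close>

class complex_hilbert = complex_vector + real_inner + banach +
  fixes cinner :: "'a \<Rightarrow> 'a \<Rightarrow> complex"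
  assumes cinner_commute: "cinner x y = cnj (cinner y x)"
    and cinner_add_right: "cinner x (y + z) = cinner x y + cinner x z"
    and cinner_scaleC_right: "cinner x (c *\<^sub>C y) = c * cinner x y"
    and Re_cinner: "Re (cinner x y) = inner x y"

context complex_hilbert
begin

lemma cinner_scaleC_left: "cinner (c *\<^sub>C x) y = cnj c * cinner x y"
  by (metis cinner_commute cinner_scaleC_right complex_cnj_cnj complex_cnj_mult)

lemma cinner_add_left: "cinner (x + y) z = cinner x z + cinner y z"
  by (metis cinner_commute cinner_add_right complex_cnj_add)

lemma cinner_self: "cinner x x = complex_of_real ((norm x)\<^sup>2)"
proof (rule complex_eqI)
  show "Re (cinner x x) = Re (complex_of_real ((norm x)\<^sup>2))"
    by (simp add: Re_cinner power2_norm_eq_inner)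
  have "cnj (cinner x x) = cinner x x" using cinner_commute[of x x] by simp
  then have "Im (cinner x x) = 0" by (metis Im_complex_of_real Reals_cases Reals_cnj_iff)
  then show "Im (cinner x x) = Im (complex_of_real ((norm x)\<^sup>2))" by simp
qed

end

subclass (in complex_hilbert) complex_normed_vector
proof
  fix c x
  have "complex_of_real ((norm (c *\<^sub>C x))\<^sup>2) = (c * cnj c) * complex_of_real ((norm x)\<^sup>2)"
    by (simp only: cinner_self[symmetric] cinner_scaleC_left cinner_scaleC_right) simp
  also have "\<dots> = complex_of_real ((cmod c * norm x)\<^sup>2)"
    by (simp add: complex_norm_square[symmetric] power_mult_distrib)
  finally have "(norm (c *\<^sub>C x))\<^sup>2 = (cmod c * norm x)\<^sup>2"
    by (simp only: of_real_eq_iff)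
  then show "norm (c *\<^sub>C x) = cmod c * norm x"
    by (simp add: power2_eq_iff_nonneg)
qed

text \<open>C*-algebras are not assumed to have a unit.\<close>

class cstar_algebra = complex_normed_vector + real_normed_algebra + banach +
  fixes star :: "'a \<Rightarrow> 'a"
  assumes scaleC_mult_left: "(c *\<^sub>C x) * y = c *\<^sub>C (x * y)"
    and scaleC_mult_right: "x * (c *\<^sub>C y) = c *\<^sub>C (x * y)"
    and star_star: "star (star x) = x"
    and star_add: "star (x + y) = star x + star y"
    and star_scaleC: "star (c *\<^sub>C x) = cnj c *\<^sub>C star x"
    and star_mult: "star (x * y) = star y * star x"
    and cstar_identity: "norm (star x * x) = (norm x)\<^sup>2"

definition bounded_clinear :: "('a::complex_normed_vector \<Rightarrow> 'b::complex_normed_vector) \<Rightarrow> bool"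
  where "bounded_clinear f \<longleftrightarrow> clinear f \<and> (\<exists>K. \<forall>x. norm (f x) \<le> K * norm x)"

definition cadjoint :: "('a::complex_hilbert \<Rightarrow> 'b::complex_hilbert) \<Rightarrow> 'b \<Rightarrow> 'a"
  where "cadjoint f = (SOME g. \<forall>x y. cinner (g y) x = cinner y (f x))"

lemma cinner_eqI:
  fixes x y :: "'a::complex_hilbert"
  assumes "\<And>z. cinner x z = cinner y z"
  shows "x = y"
proof -
  have "inner (x - y) z = 0" for z
    using arg_cong[OF assms[of z], of Re] by (simp add: Re_cinner inner_diff_left)
  then have "inner (x - y) (x - y) = 0" by blast
  then show ?thesis by simp
qed

lemma riesz_representation_real:
  fixes f :: "'a::{real_inner,complete_space} \<Rightarrow> real"
  assumes "bounded_linear f"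
  obtains y where "\<And>x. inner y x = f x"
proof -
  interpret f: bounded_linear f by fact
  obtain K where K: "\<And>x. norm (f x) \<le> norm x * K" using f.bounded by blast
  define g where "g x = inner x x - 2 * f x" for x
  have low: "g x \<ge> - (K^2)" for x
  proof -
    have "f x \<le> norm x * K" using K[of x] by simp
    moreover have "0 \<le> (norm x - K)^2" by simp
    ultimately show ?thesis
      unfolding g_def power2_norm_eq_inner[symmetric] by (simp add: power2_diff)
  qed
  define d where "d = (INF x. g x)"
  have bdd: "bdd_below (range g)" using low by (auto intro!: bdd_belowI)
  have dle: "d \<le> g x" for x unfolding d_def by (rule cINF_lower[OF bdd]) simp
  have "\<exists>x. g x < d + 1 / real (Suc n)" for n
  proof -
    have "d < d + 1 / real (Suc n)" by simp
    then show ?thesis unfolding d_def using cINF_less_iff[OF _ bdd] by blast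
  qed
  then obtain X where X: "\<And>n. g (X n) < d + 1 / real (Suc n)" by metis
  have mid: "(norm (x - y))^2 = 2 * g x + 2 * g y - 4 * g ((1/2) *\<^sub>R (x + y))" for x y
    unfolding g_def power2_norm_eq_inner
    by (simp add: inner_add_left inner_add_right inner_diff_left inner_diff_right
        f.add f.scaleR inner_commute algebra_simps)
  have close: "(norm (X m - X n))^2 < 2 / real (Suc m) + 2 / real (Suc n)" for m n
    using mid[of "X m" "X n"] X[of m] X[of n] dle[of "(1/2) *\<^sub>R (X m + X n)"] by linarith
  have "Cauchy X"
  proof (rule metric_CauchyI)
    fix e :: real assume "e > 0"
    then obtain N where N: "1 / real (Suc N) < e^2 / 4"
      using nat_approx_posE[of "e^2/4"] by auto
    have "dist (X m) (X n) < e" if "m \<ge> N" "n \<ge> N" for m n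
    proof -
      have "1 / real (Suc m) \<le> 1 / real (Suc N)" "1 / real (Suc n) \<le> 1 / real (Suc N)"
        using that by (auto simp: frac_le)
      then have "(norm (X m - X n))^2 < e^2" using close[of m n] N by linarith
      then show ?thesis using \<open>e > 0\<close> by (simp add: dist_norm power2_less_imp_less)
    qed
    then show "\<exists>M. \<forall>m\<ge>M. \<forall>n\<ge>M. dist (X m) (X n) < e" by blast
  qed
  then obtain y where y: "X \<longlonglongrightarrow> y" using Cauchy_convergent convergent_def by blast
  have "(\<lambda>n. g (X n)) \<longlonglongrightarrow> g y"
    unfolding g_def by (intro tendsto_intros y f.tendsto)
  moreover have "(\<lambda>n. d + 1 / real (Suc n)) \<longlonglongrightarrow> d + 0"
    by (intro tendsto_add tendsto_const) (rule LIMSEQ_Suc[OF lim_1_over_n])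
  ultimately have "g y \<le> d + 0"
    by (rule LIMSEQ_le) (use X less_imp_le in blast)
  then have gy: "g y \<le> g z" for z using dle[of z] by simp
  have "inner y x = f x" for x
  proof -
    define b where "b = inner y x - f x"
    have q: "0 \<le> 2 * t * b + t^2 * inner x x" for t
      using gy[of "y + t *\<^sub>R x"] unfolding g_def b_def
      by (simp add: inner_add_left inner_add_right f.add f.scaleR inner_commute
          algebra_simps power2_eq_square)
    define a where "a = inner x x + 1"
    have a: "a > 0" unfolding a_def by (simp add: add_nonneg_pos)
    have "0 \<le> 2 * (- b / a) * b + (- b / a)^2 * (a - 1)"
      using q[of "- b / a"] unfolding a_def by simp
    also have "\<dots> = - (b^2 * (a + 1) / a^2)"
      using a by (simp add: field_simps power2_eq_square)
    finally have "b^2 * (a + 1) / a^2 \<le> 0" by simp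
    moreover have "b^2 * (a + 1) / a^2 > 0" if "b \<noteq> 0"
      using a that by simp
    ultimately have "b = 0" by force
    then show ?thesis unfolding b_def by simp
  qed
  then show thesis using that by blast
qed

lemma bounded_linear_cadjoint_exists:
  fixes f :: "'a::complex_hilbert \<Rightarrow> 'b::complex_hilbert"
  assumes bl: "bounded_linear f" and cl: "clinear f"
  shows "\<exists>g. \<forall>x y. cinner (g y) x = cinner y (f x)"
proof -
  have fC: "f (c *\<^sub>C x) = c *\<^sub>C f x" for c x using cl by (simp add: clinear_iff)
  have "\<exists>z. \<forall>x. inner z x = inner y (f x)" for y
  proof -
    have "bounded_linear (\<lambda>x. inner y (f x))"
      by (rule bounded_linear_inner_right_comp[OF bl])
    then obtain z where "\<And>x. inner z x = inner y (f x)"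
      by (rule riesz_representation_real) blast
    then show ?thesis by blast
  qed
  then obtain g where g: "\<And>x y. inner (g y) x = inner y (f x)" by metis
  have "cinner (g y) x = cinner y (f x)" for x y
  proof (rule complex_eqI)
    show "Re (cinner (g y) x) = Re (cinner y (f x))" by (simp add: Re_cinner g)
    have im: "Im (cinner u v) = Re (cinner u ((- \<i>) *\<^sub>C v))" for u v :: "'d::complex_hilbert"
      by (simp only: cinner_scaleC_right) simp
    show "Im (cinner (g y) x) = Im (cinner y (f x))"
      by (simp only: im fC[symmetric] Re_cinner g)
  qed
  then show ?thesis by blast
qed

typedef (overloaded) 'h bop =
  "{T :: 'h::complex_hilbert \<Rightarrow>\<^sub>L 'h. \<forall>c x. blinfun_apply T (c *\<^sub>C x) = c *\<^sub>C blinfun_apply T x}"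
  morphisms blinfun_of_bop Abs_bop
  by (rule exI[of _ 0]) simp

setup_lifting type_definition_bop

lift_definition bop_apply :: "'h::complex_hilbert bop \<Rightarrow> 'h \<Rightarrow> 'h" is blinfun_apply .

lemma bop_apply_scaleC: "bop_apply T (c *\<^sub>C x) = c *\<^sub>C bop_apply T x"
  by transfer simp

lemma bounded_linear_bop_apply: "bounded_linear (bop_apply T)"
  by transfer (rule blinfun.bounded_linear_right)

lemma bop_eqI: "(\<And>x. bop_apply S x = bop_apply T x) \<Longrightarrow> S = T"
  by transfer (rule blinfun_eqI)

lemma clinear_bop_apply: "clinear (bop_apply T)"
  by (simp add: clinear_iff bop_apply_scaleC
      linear_add[OF bounded_linear.linear[OF bounded_linear_bop_apply]])

lemma bounded_linear_scaleC: "bounded_linear (\<lambda>x::'a::complex_normed_vector. c *\<^sub>C x)"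
proof (rule bounded_linear_intro)
  show "c *\<^sub>C r *\<^sub>R x = r *\<^sub>R c *\<^sub>C x" for r and x :: 'a
    by (simp only: scaleC_of_real[symmetric] scaleC_scaleC mult.commute)
  show "norm (c *\<^sub>C x) \<le> norm x * cmod c" for x :: 'a
    by (simp add: norm_scaleC)
qed (rule scaleC_add_right)

lemma scaleC_scaleR_commute: "c *\<^sub>C r *\<^sub>R (x::'a::complex_vector) = r *\<^sub>R c *\<^sub>C x"
  by (simp only: scaleC_of_real[symmetric] scaleC_scaleC mult.commute)

lemma scaleC_minus_right: "c *\<^sub>C (- x) = - (c *\<^sub>C (x::'a::complex_vector))"
  by (rule complex_vector.scale_minus_right)

lemma scaleC_diff_right: "c *\<^sub>C (x - y) = c *\<^sub>C x - c *\<^sub>C (y::'a::complex_vector)"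
  by (rule complex_vector.scale_right_diff_distrib)

instantiation bop :: (complex_hilbert) real_normed_vector
begin

lift_definition zero_bop :: "'a bop" is 0 by simp
lift_definition plus_bop :: "'a bop \<Rightarrow> 'a bop \<Rightarrow> 'a bop" is "(+)"
  by (simp add: blinfun.add_left scaleC_add_right)
lift_definition minus_bop :: "'a bop \<Rightarrow> 'a bop \<Rightarrow> 'a bop" is "(-)"
  by (simp add: blinfun.diff_left scaleC_diff_right)
lift_definition uminus_bop :: "'a bop \<Rightarrow> 'a bop" is uminus
  by (simp add: blinfun.minus_left scaleC_minus_right)
lift_definition scaleR_bop :: "real \<Rightarrow> 'a bop \<Rightarrow> 'a bop" is scaleR
  by (simp add: blinfun.scaleR_left scaleC_scaleR_commute)
lift_definition norm_bop :: "'a bop \<Rightarrow> real" is norm .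
definition dist_bop :: "'a bop \<Rightarrow> 'a bop \<Rightarrow> real" where "dist_bop S T = norm (S - T)"
definition sgn_bop :: "'a bop \<Rightarrow> 'a bop" where "sgn_bop T = inverse (norm T) *\<^sub>R T"
definition uniformity_bop :: "('a bop \<times> 'a bop) filter"
  where "uniformity_bop = (INF e\<in>{0 <..}. principal {(x, y). dist x y < e})"
definition open_bop :: "'a bop set \<Rightarrow> bool"
  where "open_bop S = (\<forall>x\<in>S. \<forall>\<^sub>F (x', y) in uniformity. x' = x \<longrightarrow> y \<in> S)"

instance
proof
  fix S T U :: "'a bop" and r s :: real
  show "S + T + U = S + (T + U)" by transfer simp
  show "S + T = T + S" by transfer simp
  show "0 + S = S" by transfer simp
  show "- S + S = 0" by transfer simp
  show "S - T = S + - T" by transfer simp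
  show "r *\<^sub>R (S + T) = r *\<^sub>R S + r *\<^sub>R T" by transfer (rule scaleR_add_right)
  show "(r + s) *\<^sub>R S = r *\<^sub>R S + s *\<^sub>R S" by transfer (rule scaleR_add_left)
  show "r *\<^sub>R s *\<^sub>R S = (r * s) *\<^sub>R S" by transfer simp
  show "1 *\<^sub>R S = S" by transfer simp
  show "dist S T = norm (S - T)" by (rule dist_bop_def)
  show "sgn S = inverse (norm S) *\<^sub>R S" by (rule sgn_bop_def)
  show "uniformity = (INF e\<in>{0 <..}. principal {(x :: 'a bop, y). dist x y < e})"
    by (rule uniformity_bop_def)
  show "open A = (\<forall>x\<in>A. \<forall>\<^sub>F (x', y) in uniformity. x' = x \<longrightarrow> y \<in> A)" for A :: "'a bop set"
    by (rule open_bop_def)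
  show "(norm S = 0) = (S = 0)" by transfer simp
  show "norm (S + T) \<le> norm S + norm T" by transfer (rule norm_triangle_ineq)
  show "norm (r *\<^sub>R S) = \<bar>r\<bar> * norm S" by transfer simp
qed

end

instantiation bop :: (complex_hilbert) complex_normed_vector
begin

lift_definition scaleC_bop :: "complex \<Rightarrow> 'a bop \<Rightarrow> 'a bop"
  is "\<lambda>c T. Blinfun (\<lambda>x. c *\<^sub>C blinfun_apply T x)"
  by (simp add: bounded_linear_Blinfun_apply bounded_linear_compose[OF bounded_linear_scaleC]
      blinfun.bounded_linear_right scaleC_scaleC mult.commute)

lemma bop_apply_scaleC_left: "bop_apply (c *\<^sub>C T) x = c *\<^sub>C bop_apply T x"
  by transfer (simp add: bounded_linear_Blinfun_apply bounded_linear_compose[OF bounded_linear_scaleC]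
      blinfun.bounded_linear_right)

lemma bop_apply_simps:
  "bop_apply (S + T) x = bop_apply S x + bop_apply T x"
  "bop_apply (S - T) x = bop_apply S x - bop_apply T x"
  "bop_apply (- T) x = - bop_apply T x"
  "bop_apply 0 x = 0"
  "bop_apply (r *\<^sub>R T) x = r *\<^sub>R bop_apply T x"
  by (transfer, simp add: blinfun.bilinear_simps)+

lemma norm_bop_apply: "norm (bop_apply T x) \<le> norm T * norm x"
  by transfer (rule norm_blinfun)

lemma norm_bop_bound:
  assumes "0 \<le> b" "\<And>x. norm (bop_apply T x) \<le> b * norm x"
  shows "norm T \<le> b"
  using assms by transfer (rule norm_blinfun_bound)

instance
proof
  fix S T :: "'a bop" and c d :: complex and r :: real
  show "c *\<^sub>C (S + T) = c *\<^sub>C S + c *\<^sub>C T"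
    by (rule bop_eqI) (simp add: bop_apply_scaleC_left bop_apply_simps scaleC_add_right)
  show "(c + d) *\<^sub>C S = c *\<^sub>C S + d *\<^sub>C S"
    by (rule bop_eqI) (simp add: bop_apply_scaleC_left bop_apply_simps scaleC_add_left)
  show "c *\<^sub>C d *\<^sub>C S = (c * d) *\<^sub>C S"
    by (rule bop_eqI) (simp add: bop_apply_scaleC_left scaleC_scaleC)
  show "complex_of_real r *\<^sub>C S = r *\<^sub>R S"
    by (rule bop_eqI) (simp add: bop_apply_scaleC_left bop_apply_simps scaleC_of_real)
  have le: "norm (c *\<^sub>C S) \<le> cmod c * norm S" for c and S :: "'a bop"
    by (rule norm_bop_bound)
      (auto simp: bop_apply_scaleC_left norm_scaleC mult.assoc intro!: mult_left_mono norm_bop_apply)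
  show "norm (c *\<^sub>C S) = cmod c * norm S"
  proof (cases "c = 0")
    case True
    have "0 *\<^sub>C S = 0"
      by (rule bop_eqI) (simp add: bop_apply_scaleC_left bop_apply_simps)
    then show ?thesis using True by simp
  next
    case False
    have "inverse c *\<^sub>C c *\<^sub>C S = S"
      by (rule bop_eqI) (use False in \<open>simp add: bop_apply_scaleC_left scaleC_scaleC scaleC_one\<close>)
    then have "norm S \<le> cmod (inverse c) * norm (c *\<^sub>C S)" using le[of "inverse c" "c *\<^sub>C S"] by simp
    then have "cmod c * norm S \<le> norm (c *\<^sub>C S)" using False
      by (simp only: norm_inverse) (simp add: field_simps)
    then show ?thesis using le[of c S] by simp
  qed
qed

end

lemma dist_blinfun_of_bop: "dist (blinfun_of_bop S) (blinfun_of_bop T) = dist S T"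
  unfolding dist_norm norm_bop.rep_eq minus_bop.rep_eq by (rule refl)

lemma closed_range_blinfun_of_bop: "closed (range (blinfun_of_bop :: 'a::complex_hilbert bop \<Rightarrow> _))"
proof -
  have "range (blinfun_of_bop :: 'a bop \<Rightarrow> _) =
      {T. \<forall>c x. blinfun_apply T (c *\<^sub>C x) = c *\<^sub>C blinfun_apply T x}"
    by (rule type_definition.Rep_range[OF type_definition_bop])
  also have "\<dots> = (\<Inter>c. \<Inter>x. {T. blinfun_apply T (c *\<^sub>C x) = c *\<^sub>C blinfun_apply T x})"
    by blast
  also have "closed \<dots>"
  proof (intro closed_INT ballI closed_Collect_eq)
    have ev: "continuous_on UNIV (\<lambda>T :: 'a \<Rightarrow>\<^sub>L 'a. blinfun_apply T x)" for x
      by (rule linear_continuous_on[OF blinfun.bounded_linear_left])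
    show "continuous_on UNIV (\<lambda>T :: 'a \<Rightarrow>\<^sub>L 'a. blinfun_apply T (c *\<^sub>C x))" for c x
      by (rule ev)
    show "continuous_on UNIV (\<lambda>T :: 'a \<Rightarrow>\<^sub>L 'a. c *\<^sub>C blinfun_apply T x)" for c x
      by (rule linear_continuous_on[OF bounded_linear_compose[OF bounded_linear_scaleC
            blinfun.bounded_linear_left]])
  qed
  finally show ?thesis .
qed

instance bop :: (complex_hilbert) banach
proof
  fix X :: "nat \<Rightarrow> 'a bop" assume X: "Cauchy X"
  define Y where "Y n = blinfun_of_bop (X n)" for n
  have dY: "dist (Y m) (Y n) = dist (X m) (X n)" for m n
    unfolding Y_def by (rule dist_blinfun_of_bop)
  have "Cauchy Y" using X by (simp only: Cauchy_def dY)
  then have "convergent Y" by (rule Cauchy_convergent)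
  then obtain T where T: "Y \<longlonglongrightarrow> T" unfolding convergent_def by (rule exE)
  have "T \<in> range blinfun_of_bop"
    by (rule closed_sequentially[OF closed_range_blinfun_of_bop _ T]) (simp add: Y_def)
  then obtain S where S: "T = blinfun_of_bop S" by (rule rangeE)
  have "(\<lambda>n. dist (Y n) T) \<longlonglongrightarrow> 0" using T by (rule iffD1[OF tendsto_dist_iff])
  then have "(\<lambda>n. dist (X n) S) \<longlonglongrightarrow> 0" by (simp only: Y_def S dist_blinfun_of_bop)
  then have "X \<longlonglongrightarrow> S" by (rule iffD2[OF tendsto_dist_iff])
  then show "convergent X" by (rule convergentI)
qed

lemma bounded_clinear_bop_apply: "bounded_clinear (bop_apply T)"
  unfolding bounded_clinear_def using clinear_bop_apply norm_bop_apply by blast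

instantiation bop :: (complex_hilbert) cstar_algebra
begin

lift_definition times_bop :: "'a bop \<Rightarrow> 'a bop \<Rightarrow> 'a bop" is "(o\<^sub>L)" by simp

definition star_bop :: "'a bop \<Rightarrow> 'a bop"
  where "star_bop T = (THE S. bop_apply S = cadjoint (bop_apply T))"

lemma bop_apply_times: "bop_apply (S * T) x = bop_apply S (bop_apply T x)"
  by transfer simp

lemma cinner_cadjoint_bop: "cinner (cadjoint (bop_apply T) y) x = cinner y (bop_apply T x)"
  unfolding cadjoint_def
  by (rule someI_ex[OF bounded_linear_cadjoint_exists[OF bounded_linear_bop_apply clinear_bop_apply],
        THEN spec, THEN spec])

lemma bop_apply_star: "bop_apply (star T) = cadjoint (bop_apply T)"
proof -
  let ?g = "cadjoint (bop_apply T)"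
  have gC: "?g (c *\<^sub>C y) = c *\<^sub>C ?g y" for c y
    by (rule cinner_eqI) (simp add: cinner_cadjoint_bop cinner_scaleC_left)
  have ga: "?g (x + y) = ?g x + ?g y" for x y
    by (rule cinner_eqI) (simp add: cinner_cadjoint_bop cinner_add_left)
  have bd: "norm (?g y) \<le> norm y * norm T" for y
  proof -
    have "(norm (?g y))\<^sup>2 = Re (cinner y (bop_apply T (?g y)))"
      by (simp only: cinner_cadjoint_bop[symmetric] cinner_self Re_complex_of_real)
    also have "\<dots> \<le> norm y * norm (bop_apply T (?g y))"
      by (simp add: Re_cinner norm_cauchy_schwarz)
    also have "\<dots> \<le> norm y * (norm T * norm (?g y))"
      by (intro mult_left_mono norm_bop_apply) simp
    finally have "norm (?g y) * norm (?g y) \<le> (norm y * norm T) * norm (?g y)"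
      by (simp only: power2_eq_square mult.assoc)
    then show ?thesis
      by (cases "?g y = 0") simp_all
  qed
  have "bounded_linear ?g"
  proof (rule bounded_linear_intro[OF ga _ bd])
    show "?g (r *\<^sub>R x) = r *\<^sub>R ?g x" for r x
      using gC[of "complex_of_real r" x] by (simp add: scaleC_of_real)
  qed
  then have B: "blinfun_apply (Blinfun ?g) = ?g"
    by (rule bounded_linear_Blinfun_apply)
  then have "blinfun_of_bop (Abs_bop (Blinfun ?g)) = Blinfun ?g"
    by (intro Abs_bop_inverse) (simp only: mem_Collect_eq B gC simp_thms)
  then have ex: "bop_apply (Abs_bop (Blinfun ?g)) = ?g"
    by (subst bop_apply.rep_eq[of "Abs_bop (Blinfun ?g)"]) (simp only: B)
  have "\<exists>!S. bop_apply S = ?g"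
  proof (rule ex1I)
    show "bop_apply (Abs_bop (Blinfun ?g)) = ?g" by (rule ex)
    show "S = Abs_bop (Blinfun ?g)" if "bop_apply S = ?g" for S
      by (rule bop_eqI) (simp only: that ex)
  qed
  then show ?thesis unfolding star_bop_def by (rule theI')
qed

lemma cinner_star_bop: "cinner (bop_apply (star T) y) x = cinner y (bop_apply T x)"
  by (simp only: bop_apply_star cinner_cadjoint_bop)

lemma cinner_star_bop': "cinner y (bop_apply (star T) x) = cinner (bop_apply T y) x"
  using arg_cong[OF cinner_star_bop[of T x y], of cnj] by (simp only: cinner_commute[symmetric])

instance
proof
  fix S T U :: "'a bop" and c :: complex and r :: real
  note ext = bop_apply_simps bop_apply_scaleC_left bop_apply_times bop_apply_scaleC
    linear_add[OF bounded_linear.linear[OF bounded_linear_bop_apply]]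
    linear_scale[OF bounded_linear.linear[OF bounded_linear_bop_apply]]
  show "S * T * U = S * (T * U)" by (rule bop_eqI) (simp add: ext)
  show "(S + T) * U = S * U + T * U" by (rule bop_eqI) (simp add: ext)
  show "S * (T + U) = S * T + S * U" by (rule bop_eqI) (simp add: ext)
  show "r *\<^sub>R S * T = r *\<^sub>R (S * T)" by (rule bop_eqI) (simp add: ext)
  show "S * r *\<^sub>R T = r *\<^sub>R (S * T)" by (rule bop_eqI) (simp add: ext)
  show "(c *\<^sub>C S) * T = c *\<^sub>C (S * T)" by (rule bop_eqI) (simp add: ext)
  show "S * (c *\<^sub>C T) = c *\<^sub>C (S * T)" by (rule bop_eqI) (simp add: ext)
  show mult: "norm (S * T) \<le> norm S * norm T" for S T :: "'a bop"
    by transfer (rule norm_blinfun_compose)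
  show "star (star S) = S"
    by (rule bop_eqI, rule cinner_eqI) (simp add: cinner_star_bop cinner_star_bop')
  show "star (S + T) = star S + star T"
    by (rule bop_eqI, rule cinner_eqI)
      (simp add: cinner_star_bop ext cinner_add_left cinner_add_right)
  show "star (c *\<^sub>C S) = cnj c *\<^sub>C star S"
    by (rule bop_eqI, rule cinner_eqI)
      (simp add: cinner_star_bop ext cinner_scaleC_left cinner_scaleC_right)
  show "star (S * T) = star T * star S"
    by (rule bop_eqI, rule cinner_eqI) (simp add: cinner_star_bop ext)
  have sq: "(norm S)\<^sup>2 \<le> norm (star S * S)" for S :: "'a bop"
  proof -
    have "norm (bop_apply S x) \<le> sqrt (norm (star S * S)) * norm x" for x
    proof (rule power2_le_imp_le)
      have "(norm (bop_apply S x))\<^sup>2 = Re (cinner x (bop_apply (star S * S) x))"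
        by (simp only: bop_apply_times cinner_star_bop' cinner_self Re_complex_of_real)
      also have "\<dots> \<le> norm x * norm (bop_apply (star S * S) x)"
        by (simp add: Re_cinner norm_cauchy_schwarz)
      also have "\<dots> \<le> norm x * (norm (star S * S) * norm x)"
        by (intro mult_left_mono norm_bop_apply) simp
      finally show "(norm (bop_apply S x))\<^sup>2 \<le> (sqrt (norm (star S * S)) * norm x)\<^sup>2"
        by (simp add: power_mult_distrib) (simp add: power2_eq_square ac_simps)
    qed simp
    then have "norm S \<le> sqrt (norm (star S * S))" by (intro norm_bop_bound) auto
    then have "(norm S)\<^sup>2 \<le> (sqrt (norm (star S * S)))\<^sup>2" by (rule power_mono) simp
    then show ?thesis by simp
  qed
  have le: "norm S \<le> norm (star S)" for S :: "'a bop"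
  proof -
    have "norm S * norm S \<le> norm (star S) * norm S"
      using order_trans[OF sq mult] by (simp only: power2_eq_square)
    then show ?thesis by (cases "S = 0") simp_all
  qed
  have "norm (star S) \<le> norm S"
    using le[of "star S"] \<open>star (star S) = S\<close> by simp
  then have "norm (star S * S) \<le> (norm S)\<^sup>2"
    unfolding power2_eq_square by (rule order_trans[OF mult mult_right_mono]) simp
  then show "norm (star S * S) = (norm S)\<^sup>2" using sq[of S] by simp
qed

end

definition mat_star :: "'a::cstar_algebra mat \<Rightarrow> 'a mat"
  where "mat_star X = mat (dim_col X) (dim_row X) (\<lambda>(i, j). star (X $$ (j, i)))"

text \<open>
  The algebra of \<open>n \<times> n\<close> matrices over a C*-algebra carries exactly one C*-norm, so
  \<open>mat_norm n\<close> is determined on \<open>carrier_mat n n\<close>.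
\<close>

definition is_mat_cstar_norm :: "nat \<Rightarrow> ('a::cstar_algebra mat \<Rightarrow> real) \<Rightarrow> bool"
  where "is_mat_cstar_norm n N \<longleftrightarrow>
    (\<forall>X \<in> carrier_mat n n. 0 \<le> N X \<and> (N X = 0 \<longleftrightarrow> X = 0\<^sub>m n n)) \<and>
    (\<forall>X \<in> carrier_mat n n. \<forall>c. N (map_mat ((*\<^sub>C) c) X) = cmod c * N X) \<and>
    (\<forall>X \<in> carrier_mat n n. \<forall>Y \<in> carrier_mat n n. N (X + Y) \<le> N X + N Y) \<and>
    (\<forall>X \<in> carrier_mat n n. \<forall>Y \<in> carrier_mat n n. N (X * Y) \<le> N X * N Y) \<and>
    (\<forall>X \<in> carrier_mat n n. N (mat_star X * X) = (N X)\<^sup>2)"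

definition mat_norm :: "nat \<Rightarrow> 'a::cstar_algebra mat \<Rightarrow> real"
  where "mat_norm n = (SOME N. is_mat_cstar_norm n N)"

text \<open>
  Without a unit there is no spectrum in the algebra itself, so positivity of an element of the
  C*-algebra of matrices is expressed as being of the form \<open>Y\<^sup>* Y\<close>.
\<close>

definition mat_psd :: "nat \<Rightarrow> 'a::cstar_algebra mat \<Rightarrow> bool"
  where "mat_psd n X \<longleftrightarrow> (\<exists>Y \<in> carrier_mat n n. X = mat_star Y * Y)"

definition completely_bounded :: "('a::cstar_algebra \<Rightarrow> 'b::cstar_algebra) \<Rightarrow> bool"
  where "completely_bounded \<phi> \<longleftrightarrow> clinear \<phi> \<and>
    (\<exists>K. \<forall>n. \<forall>X \<in> carrier_mat n n. mat_norm n (map_mat \<phi> X) \<le> K * mat_norm n X)"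

definition completely_positive :: "('a::cstar_algebra \<Rightarrow> 'b::cstar_algebra) \<Rightarrow> bool"
  where "completely_positive \<phi> \<longleftrightarrow> clinear \<phi> \<and>
    (\<forall>n. \<forall>X \<in> carrier_mat n n. mat_psd n X \<longrightarrow> mat_psd n (map_mat \<phi> X))"

definition real_map :: "('a::cstar_algebra \<Rightarrow> 'b::cstar_algebra) \<Rightarrow> bool"
  where "real_map \<phi> \<longleftrightarrow> (\<forall>a. star (\<phi> a) = \<phi> (star a))"

definition wittstock_decomposition ::
    "('m::cstar_algebra \<Rightarrow> 'h::complex_hilbert bop) \<Rightarrow> ('m \<Rightarrow> 'h bop) \<Rightarrow> ('m \<Rightarrow> 'h bop) \<Rightarrow> bool"
  where "wittstock_decomposition \<phi> \<phi>\<^sub>p \<phi>\<^sub>m \<longleftrightarrow>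
    completely_positive \<phi>\<^sub>p \<and> completely_positive \<phi>\<^sub>m \<and> (\<forall>a. \<phi> a = \<phi>\<^sub>p a - \<phi>\<^sub>m a)"

definition extremal_wittstock_decomposition ::
    "('m::cstar_algebra \<Rightarrow> 'h::complex_hilbert bop) \<Rightarrow> ('m \<Rightarrow> 'h bop) \<Rightarrow> ('m \<Rightarrow> 'h bop) \<Rightarrow> bool"
  where "extremal_wittstock_decomposition \<phi> \<phi>\<^sub>p \<phi>\<^sub>m \<longleftrightarrow> wittstock_decomposition \<phi> \<phi>\<^sub>p \<phi>\<^sub>m \<and>
    \<not> (\<exists>\<delta> :: 'm \<Rightarrow> 'h bop. completely_positive \<delta> \<and> \<delta> \<noteq> (\<lambda>a. 0) \<and>
        completely_positive (\<lambda>a. \<phi>\<^sub>p a - \<delta> a) \<and> completely_positive (\<lambda>a. \<phi>\<^sub>m a - \<delta> a))"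

instantiation prod :: (complex_vector, complex_vector) complex_vector
begin

definition scaleC_prod :: "complex \<Rightarrow> 'a \<times> 'b \<Rightarrow> 'a \<times> 'b"
  where "scaleC_prod c z = (c *\<^sub>C fst z, c *\<^sub>C snd z)"

instance
  by standard (simp_all add: scaleC_prod_def prod_eq_iff scaleC_add_right scaleC_add_left
      scaleC_scaleC scaleC_of_real)

end

instantiation prod :: (complex_hilbert, complex_hilbert) complex_hilbert
begin

definition cinner_prod :: "'a \<times> 'b \<Rightarrow> 'a \<times> 'b \<Rightarrow> complex"
  where "cinner_prod z w = cinner (fst z) (fst w) + cinner (snd z) (snd w)"

instance
proof
  fix x y z :: "'a \<times> 'b" and c :: complex
  show "cinner x y = cnj (cinner y x)"
    unfolding cinner_prod_def using cinner_commute by (metis complex_cnj_add)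
qed (simp_all add: cinner_prod_def scaleC_prod_def cinner_add_right cinner_scaleC_right
    Re_cinner inner_prod_def ring_distribs)

end

lift_definition bop_sum ::
    "'k::complex_hilbert bop \<Rightarrow> 'l::complex_hilbert bop \<Rightarrow> ('k \<times> 'l) bop"
  is "\<lambda>S T. Blinfun (\<lambda>z. (blinfun_apply S (fst z), blinfun_apply T (snd z)))"
  by (simp add: bounded_linear_Blinfun_apply bounded_linear_Pair scaleC_prod_def
      bounded_linear_blinfun_apply bounded_linear_fst bounded_linear_snd)

lemma bop_apply_bop_sum: "bop_apply (bop_sum S T) z = (bop_apply S (fst z), bop_apply T (snd z))"
  by transfer (simp add: bounded_linear_Blinfun_apply bounded_linear_Pair
      bounded_linear_blinfun_apply bounded_linear_fst bounded_linear_snd)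

text \<open>
  The Hilbert space of a representation is a closed subspace \<open>L\<close> of a Hilbert space type \<open>'l\<close>,
  so that a representation and its subrepresentations can have the same type.  The algebra of
  bounded operators on \<open>L\<close> is identified with the \<open>T :: 'l bop\<close> such that both \<open>T\<close> and \<open>star T\<close>
  have range in \<open>L\<close>; these vanish on the orthogonal complement of \<open>L\<close>.  Since the image of a
  representation is closed under \<open>star\<close>, it suffices to require that its operators have range in
  \<open>L\<close>.  Representations may be degenerate.
\<close>

record (overloaded) ('m, 'l) rep =
  rep_space :: "'l set"
  rep_op :: "'m \<Rightarrow> 'l bop"

definition representation :: "('m::cstar_algebra, 'l::complex_hilbert) rep \<Rightarrow> bool"
  where "representation \<pi> \<longleftrightarrow>
    csubspace (rep_space \<pi>) \<and> closed (rep_space \<pi>) \<and>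
    (\<forall>a x. bop_apply (rep_op \<pi> a) x \<in> rep_space \<pi>) \<and>
    clinear (rep_op \<pi>) \<and>
    (\<forall>a b. rep_op \<pi> (a * b) = rep_op \<pi> a * rep_op \<pi> b) \<and>
    (\<forall>a. rep_op \<pi> (star a) = star (rep_op \<pi> a))"

definition rep_sum ::
    "('m, 'k::complex_hilbert) rep \<Rightarrow> ('m, 'l::complex_hilbert) rep \<Rightarrow> ('m, 'k \<times> 'l) rep"
  where "rep_sum \<sigma> \<tau> = \<lparr>rep_space = rep_space \<sigma> \<times> rep_space \<tau>,
    rep_op = (\<lambda>a. bop_sum (rep_op \<sigma> a) (rep_op \<tau> a))\<rparr>"

definition unitary_between ::
    "'k::complex_hilbert set \<Rightarrow> 'l::complex_hilbert set \<Rightarrow> ('k \<Rightarrow> 'l) \<Rightarrow> bool"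
  where "unitary_between K L U \<longleftrightarrow> U ` K = L \<and>
    (\<forall>x\<in>K. \<forall>y\<in>K. U (x + y) = U x + U y) \<and> (\<forall>c. \<forall>x\<in>K. U (c *\<^sub>C x) = c *\<^sub>C U x) \<and>
    (\<forall>x\<in>K. \<forall>y\<in>K. cinner (U x) (U y) = cinner x y)"

definition rep_equivalent ::
    "('m, 'k::complex_hilbert) rep \<Rightarrow> ('m, 'l::complex_hilbert) rep \<Rightarrow> bool"
  where "rep_equivalent \<sigma> \<tau> \<longleftrightarrow> (\<exists>U. unitary_between (rep_space \<sigma>) (rep_space \<tau>) U \<and>
    (\<forall>a. \<forall>x\<in>rep_space \<sigma>. U (bop_apply (rep_op \<sigma> a) x) = bop_apply (rep_op \<tau> a) (U x)))"

text \<open>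
  In the next three definitions the bound representations live on the types of the given ones.
  This loses nothing: if \<open>\<pi>\<close> is equivalent to \<open>\<sigma> \<oplus> \<tau>\<close> with \<open>\<sigma>\<close> and \<open>\<tau>\<close> on arbitrary Hilbert
  spaces, then \<open>\<sigma>\<close> and \<open>\<tau>\<close> are equivalent to the restrictions of \<open>\<pi>\<close> to a closed invariant
  subspace and its orthogonal complement in \<open>rep_space \<pi>\<close>.
\<close>

definition subrepresentation ::
    "('m::cstar_algebra, 'k::complex_hilbert) rep \<Rightarrow> ('m, 'l::complex_hilbert) rep \<Rightarrow> bool"
  where "subrepresentation \<sigma> \<pi> \<longleftrightarrow> representation \<sigma> \<and> representation \<pi> \<and>
    (\<exists>\<tau> :: ('m, 'l) rep. representation \<tau> \<and> rep_equivalent \<pi> (rep_sum \<sigma> \<tau>))"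

definition totally_orthogonal ::
    "('m::cstar_algebra, 'k::complex_hilbert) rep \<Rightarrow> ('m, 'l::complex_hilbert) rep \<Rightarrow> bool"
  where "totally_orthogonal \<pi>\<^sub>1 \<pi>\<^sub>2 \<longleftrightarrow>
    \<not> (\<exists>(\<sigma> :: ('m, 'k) rep) (\<tau> :: ('m, 'l) rep). subrepresentation \<sigma> \<pi>\<^sub>1 \<and> rep_space \<sigma> \<noteq> {0} \<and>
        subrepresentation \<tau> \<pi>\<^sub>2 \<and> rep_equivalent \<sigma> \<tau>)"

definition supp_subset ::
    "('m::cstar_algebra, 'k::complex_hilbert) rep \<Rightarrow> ('m, 'l::complex_hilbert) rep \<Rightarrow> bool"
  where "supp_subset \<pi>\<^sub>1 \<pi>\<^sub>2 \<longleftrightarrow>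
    \<not> (\<exists>\<sigma> :: ('m, 'k) rep. subrepresentation \<sigma> \<pi>\<^sub>1 \<and> rep_space \<sigma> \<noteq> {0} \<and> totally_orthogonal \<sigma> \<pi>\<^sub>2)"

definition supp_eq ::
    "('m::cstar_algebra, 'k::complex_hilbert) rep \<Rightarrow> ('m, 'l::complex_hilbert) rep \<Rightarrow> bool"
  where "supp_eq \<pi>\<^sub>1 \<pi>\<^sub>2 \<longleftrightarrow> supp_subset \<pi>\<^sub>1 \<pi>\<^sub>2 \<and> supp_subset \<pi>\<^sub>2 \<pi>\<^sub>1"

text \<open>
  Minimal Stinespring factorizations are unique up to unitary equivalence, so the support of a
  completely positive map is the support of \<open>\<pi>\<close> for any of its minimal factorizations, on any
  Hilbert space.
\<close>

definition minimal_stinespring ::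
    "('m::cstar_algebra \<Rightarrow> 'h::complex_hilbert bop) \<Rightarrow> ('m, 'l::complex_hilbert) rep \<Rightarrow> ('h \<Rightarrow> 'l) \<Rightarrow> bool"
  where "minimal_stinespring \<phi> \<pi> V \<longleftrightarrow>
    representation \<pi> \<and> bounded_clinear V \<and> range V \<subseteq> rep_space \<pi> \<and>
    (\<forall>a. bop_apply (\<phi> a) = cadjoint V \<circ> bop_apply (rep_op \<pi> a) \<circ> V) \<and>
    closure (cspan {bop_apply (rep_op \<pi> a) (V x) | a x. True}) = rep_space \<pi>"

end

theory Submission
  imports Defs
begin

text \<open>
  Suppose that \<open>\<pi>\<^sub>p\<close> has a nonzero subrepresentation \<open>\<sigma>\<close> totally orthogonal to \<open>\<rho>\<^sub>p\<close>, and let \<open>\<delta> \<le> \<phi>\<^sub>p\<close> be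
  the corresponding summand of \<open>\<phi>\<^sub>p\<close>.  Since \<open>\<phi>\<^sub>p + \<psi>\<^sub>m = \<psi>\<^sub>p + \<phi>\<^sub>m\<close>, we have \<open>\<delta> \<le> \<psi>\<^sub>p + \<phi>\<^sub>m\<close>, which yields a
  contraction intertwining \<open>\<rho>\<^sub>p \<oplus> \<pi>\<^sub>m\<close> with \<open>\<sigma>\<close>.  It vanishes on the first summand, because by polar
  decomposition a nonzero intertwiner from \<open>\<rho>\<^sub>p\<close> to \<open>\<sigma>\<close> would produce equivalent nonzero
  subrepresentations.  Hence \<open>\<delta> \<le> \<phi>\<^sub>m\<close>, contradicting extremality.  The other inclusions follow by
  exchanging the decompositions and replacing \<open>\<phi>\<close> by \<open>- \<phi>\<close>.
\<close>

subsection \<open>Bounded operators and orthogonal projections\<close>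

text \<open>Order relations become contractions, and conversely, through the forms \<open>\<Sum>i<n.
  \<Sum>j<n. inner (h i) (bop_apply (\<Phi> (star (a i) * a j)) (h j))\<close>. Under a Stinespring
  factorization such a form is the squared norm of a sum of vectors
  \<open>bop_apply (rep_op \<pi> (a j)) (V (h j))\<close>, so an inequality between two forms is a
  norm inequality, which makes a map between the spans of such vectors well defined and contractive.
  In the other direction \<open>mat_psd\<close> asks for an actual factor \<open>Y\<close>, so
  nonnegative forms have to be turned into a factorization of an operator matrix. This factorization
  and the polar decomposition both rest on square roots of positive operators. The contraction is at
  first given only on a subspace of the space of
  \<open>\<rho>\<^sub>p \<oplus> \<pi>\<^sub>m\<close>. That subspace is invariant under a family of
  operators closed under \<open>star\<close>, so the orthogonal complement of its closure is
  invariant too, and the extension by zero still intertwines. Only after this extension can it be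
  restricted to one summand.\<close>

lemma bounded_clinear_imp_bounded_linear:
  assumes "bounded_clinear f" shows "bounded_linear f"
proof -
  obtain K where cl: "clinear f" and K: "\<And>x. norm (f x) \<le> K * norm x"
    using assms unfolding bounded_clinear_def by blast
  show ?thesis
  proof (rule bounded_linear_intro[where K = K])
    show "f (x + y) = f x + f y" for x y using cl by (simp add: clinear_iff)
    show "f (r *\<^sub>R x) = r *\<^sub>R f x" for r x
      using cl by (simp add: clinear_iff flip: scaleC_of_real)
    show "norm (f x) \<le> norm x * K" for x using K[of x] by (simp add: mult.commute)
  qed
qed

lemma bounded_clinear_imp_clinear: "bounded_clinear f \<Longrightarrow> clinear f"
  by (simp add: bounded_clinear_def)

lemma bounded_clinear_add: "bounded_clinear f \<Longrightarrow> f (x + y) = f x + f y"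
  and bounded_clinear_scaleC: "bounded_clinear f \<Longrightarrow> f (c *\<^sub>C x) = c *\<^sub>C f x"
  by (simp_all add: bounded_clinear_def clinear_iff)

lemma bounded_clinearI:
  assumes "\<And>x y. f (x + y) = f x + f y" "\<And>c x. f (c *\<^sub>C x) = c *\<^sub>C f x"
    and "\<And>x. norm (f x) \<le> K * norm x"
  shows "bounded_clinear f"
  using assms unfolding bounded_clinear_def clinear_iff by blast

lemma bounded_clinear_zero [simp]: "bounded_clinear f \<Longrightarrow> f 0 = 0"
  by (rule linear_0[OF bounded_linear.linear[OF bounded_clinear_imp_bounded_linear]])

lemma bounded_clinear_diff: "bounded_clinear f \<Longrightarrow> f (x - y) = f x - f y"
  by (rule linear_diff[OF bounded_linear.linear[OF bounded_clinear_imp_bounded_linear]])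

lemma bounded_clinear_sum: "bounded_clinear f \<Longrightarrow> f (sum g A) = (\<Sum>i\<in>A. f (g i))"
  by (rule linear_sum[OF bounded_linear.linear[OF bounded_clinear_imp_bounded_linear]])

lemma bounded_clinear_compose:
  assumes f: "bounded_clinear f" and g: "bounded_clinear g"
  shows "bounded_clinear (\<lambda>x. f (g x))"
proof -
  obtain K where "\<And>x. norm (f (g x)) \<le> norm x * K"
    using bounded_linear.bounded[OF bounded_linear_compose[OF f[THEN bounded_clinear_imp_bounded_linear]
      g[THEN bounded_clinear_imp_bounded_linear]]] by blast
  then show ?thesis
    by (intro bounded_clinearI[where K = K])
      (simp_all add: f g bounded_clinear_add bounded_clinear_scaleC mult.commute)
qed

lemma continuous_bounded_clinear: "bounded_clinear f \<Longrightarrow> continuous_on S f"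
  by (rule linear_continuous_on[OF bounded_clinear_imp_bounded_linear])

lemma bounded_clinear_fst: "bounded_clinear (fst :: 'a::complex_hilbert \<times> 'b::complex_hilbert \<Rightarrow> 'a)"
  by (rule bounded_clinearI[where K = 1]) (simp_all add: scaleC_prod_def norm_prod_def)

lemma bounded_clinear_snd: "bounded_clinear (snd :: 'a::complex_hilbert \<times> 'b::complex_hilbert \<Rightarrow> 'b)"
  by (rule bounded_clinearI[where K = 1]) (simp_all add: scaleC_prod_def norm_prod_def)

lemma bounded_clinear_Pair:
  fixes f :: "'a::complex_hilbert \<Rightarrow> 'b::complex_hilbert" and g :: "'a \<Rightarrow> 'c::complex_hilbert"
  assumes f: "bounded_clinear f" and g: "bounded_clinear g"
  shows "bounded_clinear (\<lambda>x. (f x, g x))"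
proof -
  obtain K where "\<And>x. norm (f x, g x) \<le> norm x * K"
    using bounded_linear.bounded[OF bounded_linear_Pair[OF f[THEN bounded_clinear_imp_bounded_linear]
      g[THEN bounded_clinear_imp_bounded_linear]]] by blast
  then show ?thesis
    by (intro bounded_clinearI[where K = K])
      (simp_all add: scaleC_prod_def f g bounded_clinear_add bounded_clinear_scaleC mult.commute)
qed

lemma bounded_clinear_zero_fun: "bounded_clinear (\<lambda>x. 0)"
  by (rule bounded_clinearI[where K = 0]) simp_all

lemma bounded_clinear_ident: "bounded_clinear (\<lambda>x. x)"
  by (rule bounded_clinearI[where K = 1]) simp_all

lemma bop_of_bounded_clinear:
  assumes f: "bounded_clinear f" obtains T where "bop_apply T = f"
proof -
  have B: "blinfun_apply (Blinfun f) = f"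
    by (rule bounded_linear_Blinfun_apply[OF bounded_clinear_imp_bounded_linear[OF f]])
  then have "blinfun_of_bop (Abs_bop (Blinfun f)) = Blinfun f"
    by (intro Abs_bop_inverse) (simp add: bounded_clinear_scaleC[OF f])
  then have "bop_apply (Abs_bop (Blinfun f)) = f"
    by (simp add: bop_apply.rep_eq B)
  then show thesis by (rule that)
qed

lemma cinner_cadjoint:
  fixes f :: "'a::complex_hilbert \<Rightarrow> 'b::complex_hilbert"
  assumes f: "bounded_clinear f"
  shows "cinner (cadjoint f y) x = cinner y (f x)"
  unfolding cadjoint_def
  by (rule someI_ex[OF bounded_linear_cadjoint_exists[OF bounded_clinear_imp_bounded_linear[OF f]
    bounded_clinear_imp_clinear[OF f]], THEN spec, THEN spec])

lemma cinner_cadjoint':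
  fixes f :: "'a::complex_hilbert \<Rightarrow> 'b::complex_hilbert"
  assumes f: "bounded_clinear f"
  shows "cinner x (cadjoint f y) = cinner (f x) y"
  using arg_cong[OF cinner_cadjoint[OF f, of y x], of cnj] by (simp flip: cinner_commute)

lemma norm_cinner_le:
  fixes x y :: "'a::complex_hilbert"
  shows "cmod (cinner x y) \<le> norm x * norm y"
proof (cases "cinner x y = 0")
  case False
  \<comment> \<open>The phase \<open>c\<close> rotates \<open>y\<close> so that the inner product
    becomes real and nonnegative, and the real Cauchy-Schwarz inequality applies.\<close>
  define c where "c = cnj (cinner x y) / cmod (cinner x y)"
  have c: "cmod c = 1" using False by (simp add: c_def norm_divide)
  have "cinner x (c *\<^sub>C y) = cmod (cinner x y)"
    using False by (simp add: cinner_scaleC_right c_def mult.commute complex_norm_square[symmetric]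
        power2_eq_square divide_simps)
  then have "cmod (cinner x y) = inner x (c *\<^sub>C y)" by (metis Re_cinner Re_complex_of_real)
  also have "\<dots> \<le> norm x * norm (c *\<^sub>C y)" by (rule norm_cauchy_schwarz)
  finally show ?thesis by (simp add: norm_scaleC c)
qed simp

lemma bounded_clinear_cadjoint:
  fixes f :: "'a::complex_hilbert \<Rightarrow> 'b::complex_hilbert"
  assumes f: "bounded_clinear f"
  shows "bounded_clinear (cadjoint f)"
proof -
  obtain K where K: "\<And>x. norm (f x) \<le> norm x * K" "0 \<le> K"
    using bounded_linear.nonneg_bounded[OF bounded_clinear_imp_bounded_linear[OF f]] by blast
  show ?thesis
  proof (rule bounded_clinearI[where K = K])
    show "cadjoint f (x + y) = cadjoint f x + cadjoint f y" for x y
      by (rule cinner_eqI) (simp add: cinner_cadjoint[OF f] cinner_add_left)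
    show "cadjoint f (c *\<^sub>C x) = c *\<^sub>C cadjoint f x" for c x
      by (rule cinner_eqI) (simp add: cinner_cadjoint[OF f] cinner_scaleC_left)
    show "norm (cadjoint f y) \<le> K * norm y" for y
    proof (cases "cadjoint f y = 0")
      case False
      have "norm (cadjoint f y) * norm (cadjoint f y) = cmod (cinner (cadjoint f y) (cadjoint f y))"
        by (simp add: cinner_self norm_mult power2_eq_square)
      also have "\<dots> = cmod (cinner y (f (cadjoint f y)))" by (simp add: cinner_cadjoint[OF f])
      also have "\<dots> \<le> norm y * (norm (cadjoint f y) * K)"
        by (rule order_trans[OF norm_cinner_le mult_left_mono[OF K(1)]]) simp
      finally show ?thesis using False by (simp add: mult_ac)
    qed (simp add: K)
  qed
qed

lemma cinner_zero_left [simp]: "cinner 0 (x::'a::complex_hilbert) = 0"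
  and cinner_zero_right [simp]: "cinner (x::'a::complex_hilbert) 0 = 0"
  using cinner_scaleC_left[of 0 0 x] cinner_scaleC_right[of x 0 0] by simp_all

lemma cinner_minus_left [simp]: "cinner (- x) (y::'a::complex_hilbert) = - cinner x y"
  using cinner_add_left[of x "- x" y] by (simp add: eq_neg_iff_add_eq_0 add.commute)

lemma cinner_minus_right [simp]: "cinner (x::'a::complex_hilbert) (- y) = - cinner x y"
  using cinner_add_right[of x y "- y"] by (simp add: eq_neg_iff_add_eq_0 add.commute)

lemma cinner_diff_left: "cinner (x - z) (y::'a::complex_hilbert) = cinner x y - cinner z y"
  using cinner_add_left[of x "- z" y] by simp

lemma cinner_diff_right: "cinner (x::'a::complex_hilbert) (y - z) = cinner x y - cinner x z"
  using cinner_add_right[of x y "- z"] by simp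

lemma norm_eq_of_cinner_eq:
  fixes x :: "'a::complex_hilbert" and y :: "'b::complex_hilbert"
  assumes "cinner x x = cinner y y" shows "norm x = norm y"
  using assms by (simp only: cinner_self of_real_eq_iff) simp

section \<open>Closed complex subspaces and orthogonal projections\<close>

lemma csubspace_closure:
  fixes S :: "'a::complex_normed_vector set"
  assumes S: "csubspace S" shows "csubspace (closure S)"
proof (rule complex_vector.subspaceI)
  show "0 \<in> closure S" using complex_vector.subspace_0[OF S] closure_subset by blast
  show "x + y \<in> closure S" if x: "x \<in> closure S" and y: "y \<in> closure S" for x y
  proof -
    obtain f where "\<And>n. f n \<in> S" "f \<longlonglongrightarrow> x"
      using x unfolding closure_sequential by blast
    moreover obtain g where "\<And>n. g n \<in> S" "g \<longlonglongrightarrow> y"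
      using y unfolding closure_sequential by blast
    ultimately have "\<And>n. f n + g n \<in> S" "(\<lambda>n. f n + g n) \<longlonglongrightarrow> x + y"
      using complex_vector.subspace_add[OF S] by (auto intro: tendsto_add)
    then show ?thesis unfolding closure_sequential by (intro exI[of _ "\<lambda>n. f n + g n"]) simp
  qed
  show "c *\<^sub>C x \<in> closure S" if x: "x \<in> closure S" for c x
  proof -
    obtain f where f: "\<And>n. f n \<in> S" "f \<longlonglongrightarrow> x"
      using x unfolding closure_sequential by blast
    then have "\<And>n. c *\<^sub>C f n \<in> S" "(\<lambda>n. c *\<^sub>C f n) \<longlonglongrightarrow> c *\<^sub>C x"
      using complex_vector.subspace_scale[OF S]
      by (auto intro: bounded_linear.tendsto[OF bounded_linear_scaleC])
    then show ?thesis unfolding closure_sequential by (intro exI[of _ "\<lambda>n. c *\<^sub>C f n"]) simp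
  qed
qed

text \<open>A sequence in \<open>K\<close> minimizing the squared distance to \<open>x\<close> is
  Cauchy by the parallelogram law. Its limit \<open>p\<close> is a nearest point, and moving
  \<open>p\<close> along a line in \<open>K\<close> cannot decrease the distance, which forces
  orthogonality.\<close>

lemma orthogonal_projection_exists:
  fixes K :: "'a::complex_hilbert set"
  assumes K: "csubspace K" "closed K"
  shows "\<exists>p\<in>K. \<forall>k\<in>K. inner (x - p) k = 0"
proof -
  have Kadd: "k + l \<in> K" and Kscale: "r *\<^sub>R k \<in> K" if "k \<in> K" "l \<in> K" for k l r
    using that complex_vector.subspace_add[OF K(1)] complex_vector.subspace_scale[OF K(1)]
    by (simp_all flip: scaleC_of_real)
  have K0: "0 \<in> K" by (rule complex_vector.subspace_0[OF K(1)])
  define g where "g k = (norm (x - k))\<^sup>2" for k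
  define d where "d = (INF k\<in>K. g k)"
  have bdd: "bdd_below (g ` K)" by (rule bdd_belowI[of _ 0]) (auto simp: g_def)
  have dle: "d \<le> g k" if "k \<in> K" for k unfolding d_def by (rule cINF_lower[OF bdd that])
  have "\<exists>k\<in>K. g k < d + 1 / real (Suc n)" for n
  proof -
    have "d < d + 1 / real (Suc n)" by simp
    then show ?thesis unfolding d_def using cINF_less_iff[OF _ bdd] K0 by blast
  qed
  then obtain X where XK: "\<And>n. X n \<in> K" and X: "\<And>n. g (X n) < d + 1 / real (Suc n)" by metis
  have mid: "(norm (k - l))\<^sup>2 = 2 * g k + 2 * g l - 4 * g ((1/2) *\<^sub>R (k + l))" for k l
    unfolding g_def power2_norm_eq_inner
    by (simp add: inner_add_left inner_add_right inner_diff_left inner_diff_right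
        inner_commute algebra_simps)
  have close: "(norm (X m - X n))\<^sup>2 < 2 / real (Suc m) + 2 / real (Suc n)" for m n
    using mid[of "X m" "X n"] X[of m] X[of n] dle[OF Kscale[OF Kadd[OF XK[of m] XK[of n]] K0, of "1/2"]]
    by linarith
  have "Cauchy X"
  proof (rule metric_CauchyI)
    fix e :: real assume "e > 0"
    then obtain N where N: "1 / real (Suc N) < e\<^sup>2 / 4"
      using nat_approx_posE[of "e\<^sup>2/4"] by auto
    have "dist (X m) (X n) < e" if "m \<ge> N" "n \<ge> N" for m n
    proof -
      have "1 / real (Suc m) \<le> 1 / real (Suc N)" "1 / real (Suc n) \<le> 1 / real (Suc N)"
        using that by (auto simp: frac_le)
      then have "(norm (X m - X n))\<^sup>2 < e\<^sup>2" using close[of m n] N by linarith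
      then show ?thesis using \<open>e > 0\<close> by (simp add: dist_norm power2_less_imp_less)
    qed
    then show "\<exists>M. \<forall>m\<ge>M. \<forall>n\<ge>M. dist (X m) (X n) < e" by blast
  qed
  then obtain p where p: "X \<longlonglongrightarrow> p" using Cauchy_convergent convergent_def by blast
  have pK: "p \<in> K" by (rule closed_sequentially[OF K(2) XK p])
  have "(\<lambda>n. g (X n)) \<longlonglongrightarrow> g p" unfolding g_def by (intro tendsto_intros p)
  moreover have "(\<lambda>n. d + 1 / real (Suc n)) \<longlonglongrightarrow> d + 0"
    by (intro tendsto_add tendsto_const) (rule LIMSEQ_Suc[OF lim_1_over_n])
  ultimately have "g p \<le> d + 0"
    by (rule LIMSEQ_le) (use X less_imp_le in blast)
  then have gp: "g p \<le> g k" if "k \<in> K" for k using dle[OF that] by simp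
  have "inner (x - p) k = 0" if k: "k \<in> K" for k
  proof -
    define b where "b = inner (x - p) k"
    have q: "2 * t * b \<le> t\<^sup>2 * inner k k" for t
      using gp[OF Kadd[OF pK Kscale[OF k K0, of t]]] unfolding g_def b_def power2_norm_eq_inner
      by (simp add: inner_add_left inner_add_right inner_diff_left inner_diff_right inner_commute
          algebra_simps power2_eq_square)
    show ?thesis
    proof (cases "k = 0")
      case False
      then have kk: "inner k k > 0" by simp
      \<comment> \<open>The chosen \<open>t\<close> turns \<open>q\<close> into
        \<open>2 * b\<^sup>2 / inner k k \<le> b\<^sup>2 / inner k k\<close>.\<close>
      have "b\<^sup>2 \<le> 0" using q[of "b / inner k k"] kk by (simp add: field_simps power2_eq_square)
      then show ?thesis by (simp add: b_def)
    qed simp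
  qed
  then show ?thesis using pK by blast
qed

text \<open>An element of \<open>bop\<close> rather than a function, so that it can be multiplied
  with operators of a representation and tested for commutation. The choice is meaningful for closed
  complex subspaces.\<close>

definition proj :: "'a::complex_hilbert set \<Rightarrow> 'a bop"
  where "proj K = (SOME P. (\<forall>x. bop_apply P x \<in> K) \<and> (\<forall>x. \<forall>k\<in>K. cinner (x - bop_apply P x) k = 0))"

text \<open>The imaginary part of \<open>cinner x k\<close> is the real part of
  \<open>cinner x ((- \<i>) *\<^sub>C k)\<close>, and \<open>K\<close> is closed under
  multiplication by \<open>- \<i>\<close>.\<close>

lemma cinner_zero_if_inner_zero_on_csubspace:
  fixes x :: "'a::complex_hilbert"
  assumes K: "csubspace K" and x: "\<forall>k\<in>K. inner x k = 0" and k: "k \<in> K"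
  shows "cinner x k = 0"
proof (rule complex_eqI)
  show "Re (cinner x k) = Re 0" using x k by (simp add: Re_cinner)
  have "Re (cinner x ((- \<i>) *\<^sub>C k)) = 0"
    using x complex_vector.subspace_scale[OF K k] by (simp only: Re_cinner)
  then show "Im (cinner x k) = Im 0" by (simp only: cinner_scaleC_right) simp
qed

text \<open>A point of \<open>K\<close> with residual orthogonal to \<open>K\<close> is unique,
  hence depends linearly on \<open>x\<close>; Pythagoras bounds its norm. Thus an operator as
  described in \<open>proj\<close> exists and the choice is justified.\<close>

lemma
  fixes K :: "'a::complex_hilbert set"
  assumes K: "csubspace K" "closed K"
  shows proj_in: "bop_apply (proj K) x \<in> K"
    and proj_orthogonal: "k \<in> K \<Longrightarrow> cinner (x - bop_apply (proj K) x) k = 0"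
proof -
  obtain p where pK: "\<And>x. p x \<in> K" and po: "\<And>x k. k \<in> K \<Longrightarrow> cinner (x - p x) k = 0"
    using orthogonal_projection_exists[OF K] cinner_zero_if_inner_zero_on_csubspace[OF K(1)] by metis
  have uniq: "p x = q" if "q \<in> K" "\<And>k. k \<in> K \<Longrightarrow> cinner (x - q) k = 0" for x q
  proof -
    have "p x - q \<in> K" by (intro complex_vector.subspace_diff[OF K(1)] pK that)
    then have "cinner (x - q) (p x - q) - cinner (x - p x) (p x - q) = 0" by (simp add: po that)
    then have "cinner (p x - q) (p x - q) = 0" by (simp flip: cinner_diff_left)
    then show ?thesis by (simp add: cinner_self)
  qed
  have "bounded_clinear p"
  proof (rule bounded_clinearI[where K = 1])
    show "p (x + y) = p x + p y" for x y
    proof (rule uniq)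
      show "cinner (x + y - (p x + p y)) k = 0" if "k \<in> K" for k
        using po[OF that, of x] po[OF that, of y] by (simp add: cinner_diff_left cinner_add_left)
    qed (intro complex_vector.subspace_add[OF K(1)] pK)
    show "p (c *\<^sub>C x) = c *\<^sub>C p x" for c x
    proof (rule uniq)
      show "cinner (c *\<^sub>C x - c *\<^sub>C p x) k = 0" if "k \<in> K" for k
        using po[OF that, of x] by (simp add: cinner_scaleC_left flip: scaleC_diff_right)
    qed (intro complex_vector.subspace_scale[OF K(1)] pK)
    show "norm (p x) \<le> 1 * norm x" for x
    proof -
      have "inner (x - p x) (p x) = 0" using po[OF pK, of x x] by (simp flip: Re_cinner)
      then have "(norm (p x))\<^sup>2 + (norm (x - p x))\<^sup>2 = (norm x)\<^sup>2"
        unfolding power2_norm_eq_inner by (simp add: inner_diff_left inner_diff_right inner_commute)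
      then have "(norm (p x))\<^sup>2 \<le> (norm x)\<^sup>2" by (smt (verit) zero_le_power2)
      then show ?thesis by (simp add: power2_le_iff_abs_le)
    qed
  qed
  then obtain P where "bop_apply P = p" by (rule bop_of_bounded_clinear)
  then have "\<exists>P. (\<forall>x. bop_apply P x \<in> K) \<and> (\<forall>x. \<forall>k\<in>K. cinner (x - bop_apply P x) k = 0)"
    using pK po by metis
  from someI_ex[OF this, folded proj_def]
  show "bop_apply (proj K) x \<in> K" "k \<in> K \<Longrightarrow> cinner (x - bop_apply (proj K) x) k = 0" by blast+
qed

lemma bop_apply_add: "bop_apply T (x + y) = bop_apply T x + bop_apply T y"
  by (rule bounded_clinear_add[OF bounded_clinear_bop_apply])

lemma bop_apply_diff: "bop_apply T (x - y) = bop_apply T x - bop_apply T y"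
  by (rule bounded_clinear_diff[OF bounded_clinear_bop_apply])

lemma bop_apply_zero [simp]: "bop_apply T 0 = 0"
  by (rule bounded_clinear_zero[OF bounded_clinear_bop_apply])

lemma bop_apply_sum_left: "bop_apply (sum T A) x = (\<Sum>i\<in>A. bop_apply (T i) x)"
  by (induction A rule: infinite_finite_induct) (simp_all add: bop_apply_simps)

lemma bop_eqI_cinner: "(\<And>x y. cinner x (bop_apply S y) = cinner x (bop_apply T y)) \<Longrightarrow> S = T"
  by (rule bop_eqI, rule cinner_eqI) (metis cinner_commute)

lemma bop_eqI_inner:
  assumes "\<And>x y. inner x (bop_apply S y) = inner x (bop_apply T y)" shows "S = T"
  by (rule bop_eqI) (use assms vector_eq_ldot in blast)

lemma inner_star: "inner (bop_apply (star T) y) x = inner y (bop_apply T x)"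
  using arg_cong[OF cinner_star_bop[of T y x], of Re] by (simp add: Re_cinner)

lemma inner_star': "inner y (bop_apply (star T) x) = inner (bop_apply T y) x"
  by (metis inner_commute inner_star)

lemma star_eqI_inner:
  assumes "\<And>x y. inner (bop_apply S x) y = inner x (bop_apply S y)" shows "star S = S"
  by (rule bop_eqI_inner) (simp add: inner_star' assms)

lemma star_zero [simp]: "star (0::'a::cstar_algebra) = 0"
  using star_add[of "0::'a" 0] by simp

lemma star_minus [simp]: "star (- x) = - star (x::'a::cstar_algebra)"
  using star_add[of x "- x"] by (simp add: eq_neg_iff_add_eq_0 add.commute)

lemma star_diff: "star (x - y) = star x - star (y::'a::cstar_algebra)"
  using star_add[of x "- y"] by simp

lemma star_sum: "star (sum f A) = (\<Sum>i\<in>A. star (f i :: 'a::cstar_algebra))"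
  by (induction A rule: infinite_finite_induct) (simp_all add: star_add)

lemma star_scaleR: "star (r *\<^sub>R x) = r *\<^sub>R star (x::'a::cstar_algebra)"
  using star_scaleC[of "complex_of_real r" x] by (simp add: scaleC_of_real)

context
  fixes K :: "'a::complex_hilbert set"
  assumes K: "csubspace K" "closed K"
begin

lemma proj_eqI:
  assumes "q \<in> K" "\<And>k. k \<in> K \<Longrightarrow> cinner (x - q) k = 0"
  shows "bop_apply (proj K) x = q"
proof -
  let ?p = "bop_apply (proj K) x"
  have "?p - q \<in> K" by (intro complex_vector.subspace_diff[OF K(1)] proj_in[OF K] assms)
  then have "cinner (x - q) (?p - q) - cinner (x - ?p) (?p - q) = 0"
    by (simp add: assms proj_orthogonal[OF K])
  then have "cinner (?p - q) (?p - q) = 0" by (simp flip: cinner_diff_left)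
  then show ?thesis by (simp add: cinner_self)
qed

lemma proj_ident: "k \<in> K \<Longrightarrow> bop_apply (proj K) k = k"
  by (rule proj_eqI) simp_all

lemma proj_proj: "bop_apply (proj K) (bop_apply (proj K) x) = bop_apply (proj K) x"
  by (rule proj_ident[OF proj_in[OF K]])

lemma cinner_proj_left: "k \<in> K \<Longrightarrow> cinner (bop_apply (proj K) x) k = cinner x k"
  using proj_orthogonal[OF K, of k x] by (simp add: cinner_diff_left)

lemma cinner_proj_right: "k \<in> K \<Longrightarrow> cinner k (bop_apply (proj K) x) = cinner k x"
  using cinner_proj_left by (metis cinner_commute)

lemma star_proj: "star (proj K) = proj K"
  by (rule bop_eqI_cinner)
    (metis cinner_star_bop' cinner_proj_left cinner_proj_right proj_in[OF K])

lemma cinner_proj_selfadjoint: "cinner (bop_apply (proj K) x) y = cinner x (bop_apply (proj K) y)"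
  using cinner_star_bop[of "proj K" x y] by (simp add: star_proj)

lemma norm_proj_le: "norm (bop_apply (proj K) x) \<le> norm x"
proof (cases "bop_apply (proj K) x = 0")
  case False
  have "cmod (cinner (bop_apply (proj K) x) (bop_apply (proj K) x)) = cmod (cinner x (bop_apply (proj K) x))"
    by (simp add: cinner_proj_left proj_in[OF K])
  also have "\<dots> \<le> norm x * norm (bop_apply (proj K) x)" by (rule norm_cinner_le)
  finally show ?thesis using False by (simp add: cinner_self norm_mult power2_eq_square)
qed simp

text \<open>As \<open>star T\<close> preserves \<open>K\<close>, the operator \<open>T\<close>
  preserves the orthogonal complement, so applying \<open>T\<close> to the decomposition of
  \<open>x\<close> gives the decomposition of \<open>bop_apply T x\<close>.\<close>

lemma proj_commute:
  assumes T: "\<And>k. k \<in> K \<Longrightarrow> bop_apply T k \<in> K" "\<And>k. k \<in> K \<Longrightarrow> bop_apply (star T) k \<in> K"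
  shows "bop_apply (proj K) (bop_apply T x) = bop_apply T (bop_apply (proj K) x)"
proof (rule proj_eqI)
  show "cinner (bop_apply T x - bop_apply T (bop_apply (proj K) x)) k = 0" if "k \<in> K" for k
    using proj_orthogonal[OF K T(2)[OF that], of x] by (simp add: cinner_star_bop' bop_apply_diff)
qed (intro T proj_in[OF K])

end

lemma continuous_bop_apply: "continuous_on S (bop_apply T)"
  by (rule continuous_bounded_clinear[OF bounded_clinear_bop_apply])

subsection \<open>Square roots of positive operators\<close>

text \<open>
  The operator iteration converges in norm to \<open>1 - sqrt (1 - X)\<close> for \<open>norm X \<le> 1\<close>, since its increments are
  bounded by those of the scalar iteration with \<open>X = 1\<close>.
\<close>

fun sqrt_iter_real :: "nat \<Rightarrow> real"
  where "sqrt_iter_real 0 = 0"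
  | "sqrt_iter_real (Suc n) = (1 + (sqrt_iter_real n)\<^sup>2) / 2"

fun sqrt_iter :: "'h::complex_hilbert bop \<Rightarrow> nat \<Rightarrow> 'h bop"
  where "sqrt_iter X 0 = 0"
  | "sqrt_iter X (Suc n) = (1/2) *\<^sub>R (X + sqrt_iter X n * sqrt_iter X n)"

lemma sqrt_iter_real_bounds: "0 \<le> sqrt_iter_real n" "sqrt_iter_real n \<le> 1"
proof (induction n)
  case (Suc n)
  { case 2 show ?case using Suc by (simp add: power_le_one) }
  { case 1 show ?case using Suc by simp }
qed simp_all

lemma Cauchy_sqrt_iter_real: "Cauchy sqrt_iter_real"
proof -
  have "sqrt_iter_real n \<le> sqrt_iter_real (Suc n)" for n
    using zero_le_power2[of "sqrt_iter_real n - 1"] by (simp add: power2_diff)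
  then have "incseq sqrt_iter_real" by (rule incseq_SucI)
  then have "convergent sqrt_iter_real"
    by (rule Bseq_monoseq_convergent[OF _ incseq_imp_monoseq, rotated])
      (rule BseqI'[of _ 1], simp add: sqrt_iter_real_bounds)
  then show ?thesis by (rule convergent_Cauchy)
qed

context
  fixes X :: "'h::complex_hilbert bop"
  assumes X: "norm X \<le> 1"
begin

lemma norm_sqrt_iter_le: "norm (sqrt_iter X n) \<le> sqrt_iter_real n"
proof (induction n)
  case (Suc n)
  have "norm (X + sqrt_iter X n * sqrt_iter X n) \<le> 1 + sqrt_iter_real n * sqrt_iter_real n"
    by (intro norm_triangle_mono X order_trans[OF norm_mult_ineq mult_mono] Suc sqrt_iter_real_bounds) simp
  then show ?case by (simp add: power2_eq_square)
qed simp

text \<open>The splitting \<open>?Z * (?Z - ?Y) + (?Z - ?Y) * ?Y\<close> of the difference of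
  squares needs no commutativity, and every factor is bounded by its scalar counterpart. For the
  scalars the same expression is exactly twice the next increment.\<close>

lemma norm_sqrt_iter_diff_Suc_le:
  "norm (sqrt_iter X (Suc n) - sqrt_iter X n) \<le> sqrt_iter_real (Suc n) - sqrt_iter_real n"
proof (induction n)
  case 0
  then show ?case using X by simp
next
  case (Suc n)
  let ?Y = "sqrt_iter X n" and ?Z = "sqrt_iter X (Suc n)"
  let ?y = "sqrt_iter_real n" and ?z = "sqrt_iter_real (Suc n)"
  have "?Z * ?Z - ?Y * ?Y = ?Z * (?Z - ?Y) + (?Z - ?Y) * ?Y"
    by (simp add: right_diff_distrib left_diff_distrib del: sqrt_iter.simps)
  then have "norm (?Z * ?Z - ?Y * ?Y) \<le> ?z * (?z - ?y) + (?z - ?y) * ?y"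
    using Suc norm_sqrt_iter_le[of n] norm_sqrt_iter_le[of "Suc n"] sqrt_iter_real_bounds[of "Suc n"]
      order_trans[OF norm_ge_zero Suc]
    by (simp del: sqrt_iter.simps sqrt_iter_real.simps)
      (intro norm_triangle_mono order_trans[OF norm_mult_ineq] mult_mono; auto simp del: sqrt_iter.simps sqrt_iter_real.simps intro: order_trans[OF norm_ge_zero])
  moreover have "sqrt_iter X (Suc (Suc n)) - ?Z = (1/2) *\<^sub>R (?Z * ?Z - ?Y * ?Y)"
    by (simp only: sqrt_iter.simps(2)[of X "Suc n"] sqrt_iter.simps(2)[of X n] scaleR_right_diff_distrib[symmetric]) simp
  moreover have "sqrt_iter_real (Suc (Suc n)) - ?z = (1/2) * (?z * (?z - ?y) + (?z - ?y) * ?y)"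
    by (simp only: sqrt_iter_real.simps(2)[of "Suc n"]) (simp add: power2_eq_square field_simps)
  ultimately show ?case by (simp only: norm_scaleR) simp
qed

lemma norm_sqrt_iter_diff_le:
  "m \<le> n \<Longrightarrow> norm (sqrt_iter X n - sqrt_iter X m) \<le> sqrt_iter_real n - sqrt_iter_real m"
proof (induction n rule: dec_induct)
  case (step n)
  have "norm (sqrt_iter X (Suc n) - sqrt_iter X m)
      \<le> norm (sqrt_iter X (Suc n) - sqrt_iter X n) + norm (sqrt_iter X n - sqrt_iter X m)"
    using norm_triangle_ineq[of "sqrt_iter X (Suc n) - sqrt_iter X n" "sqrt_iter X n - sqrt_iter X m"] by simp
  with step.IH norm_sqrt_iter_diff_Suc_le[of n] show ?case by linarith
qed simp

lemma convergent_sqrt_iter: "convergent (sqrt_iter X)"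
proof -
  have "dist (sqrt_iter X m) (sqrt_iter X n) \<le> dist (sqrt_iter_real m) (sqrt_iter_real n)" for m n
    using norm_sqrt_iter_diff_le[of m n] norm_sqrt_iter_diff_le[of n m]
    by (cases "m \<le> n") (auto simp: dist_norm norm_minus_commute)
  then have "Cauchy (sqrt_iter X)"
    using Cauchy_sqrt_iter_real unfolding Cauchy_def by (meson le_less_trans)
  then show ?thesis by (rule Cauchy_convergent)
qed

end

text \<open>For \<open>0 \<le> X \<le> 1\<close> one has \<open>X * X \<le> X \<le> 1\<close> as
  quadratic forms, which says that \<open>X\<close> does not increase norms. This converts the order
  bounds into the norm bound under which the iteration converges.\<close>

lemma bop_norm_le_one:
  assumes X: "star X = X" "\<And>x. 0 \<le> inner x (bop_apply X x)"
    "\<And>x. inner x (bop_apply X x) \<le> inner x x"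
  shows "norm (X :: 'h::complex_hilbert bop) \<le> 1"
proof (rule norm_bop_bound)
  fix y
  let ?u = "bop_apply X y"
  have s: "inner (bop_apply X u) v = inner u (bop_apply X v)" for u v
    using inner_star[of X u v] X(1) by simp
  \<comment> \<open>\<open>X - X\<^sup>2 = X (1 - X) X + (1 - X) X (1 - X) \<ge> 0\<close>\<close>
  have "0 \<le> (inner ?u ?u - inner ?u (bop_apply X ?u)) + inner (y - ?u) (bop_apply X (y - ?u))"
    using X(3)[of ?u] X(2)[of "y - ?u"] by simp
  also have "\<dots> = inner y ?u - inner ?u ?u"
    using s[of y y] s[of y ?u] s[of ?u y] by (simp add: bop_apply_diff inner_diff_left inner_diff_right inner_commute)
  also have "\<dots> \<le> inner y y - inner ?u ?u" using X(3)[of y] by simp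
  finally have "(norm ?u)\<^sup>2 \<le> (norm y)\<^sup>2" by (simp add: power2_norm_eq_inner)
  then show "norm ?u \<le> 1 * norm y" by (simp add: power2_le_iff_abs_le)
qed simp

text \<open>Rescaling gives \<open>0 \<le> X \<le> 1\<close> for \<open>X = I - A / c\<close>. The
  limit \<open>Y\<close> satisfies \<open>2 Y = X + Y * Y\<close>, that is,
  \<open>(I - Y) * (I - Y) = A / c\<close>. The iterates are polynomials in \<open>X\<close>, so
  everything commuting with \<open>A\<close> commutes with the limit; this clause later makes the
  square root an intertwiner.\<close>

lemma bop_sqrt_exists:
  assumes A: "star A = A" "\<And>x. 0 \<le> inner x (bop_apply A x)"
  obtains S :: "'h::complex_hilbert bop" where "star S = S" "S * S = A"
    "\<And>T. T * A = A * T \<Longrightarrow> T * S = S * T"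
proof -
  obtain I :: "'h bop" where "bop_apply I = (\<lambda>x. x)"
    by (rule bop_of_bounded_clinear[OF bounded_clinear_ident])
  then have I: "bop_apply I x = x" for x by simp
  have I_mult [simp]: "I * T = T" "T * I = T" for T by (simp_all add: bop_eqI I bop_apply_times)
  have star_I: "star I = I" by (rule star_eqI_inner) (simp add: I)
  \<comment> \<open>The summand 1 keeps \<open>c\<close> positive when \<open>A = 0\<close>.\<close>
  define c where "c = norm A + 1"
  have c: "c > 0" by (simp add: c_def add_nonneg_pos)
  define X where "X = I - (1 / c) *\<^sub>R A"
  have Xx: "inner x (bop_apply X x) = inner x x - inner x (bop_apply A x) / c" for x
    by (simp add: X_def bop_apply_simps I inner_diff_right)
  have A_le: "inner x (bop_apply A x) \<le> c * inner x x" for x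
  proof -
    have "inner x (bop_apply A x) \<le> norm x * (norm A * norm x)"
      by (rule order_trans[OF norm_cauchy_schwarz mult_left_mono[OF norm_bop_apply]]) simp
    also have "\<dots> = norm A * inner x x" by (simp add: power2_norm_eq_inner[symmetric] power2_eq_square)
    also have "\<dots> \<le> c * inner x x" by (simp add: c_def distrib_right)
    finally show ?thesis .
  qed
  have "norm X \<le> 1"
  proof (rule bop_norm_le_one; (unfold Xx)?)
    show "star X = X" by (simp add: X_def star_diff star_scaleR star_I A)
    show "0 \<le> inner x x - inner x (bop_apply A x) / c" for x
      using A_le[of x] c by (simp add: field_simps)
    show "inner x x - inner x (bop_apply A x) / c \<le> inner x x" for x
      using A(2)[of x] c by simp
  qed
  then obtain Y where Y: "sqrt_iter X \<longlonglongrightarrow> Y" using convergent_sqrt_iter convergentD by blast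
  have "(\<lambda>n. sqrt_iter X (Suc n)) \<longlonglongrightarrow> (1/2) *\<^sub>R (X + Y * Y)"
    unfolding sqrt_iter.simps by (intro tendsto_intros Y)
  then have Y2: "Y = (1/2) *\<^sub>R (X + Y * Y)" using LIMSEQ_Suc[OF Y] LIMSEQ_unique by blast
  have "2 *\<^sub>R Y = X + Y * Y" using arg_cong[OF Y2, of "scaleR 2"] by simp
  then have Y_sq: "Y * Y = 2 *\<^sub>R Y - X" by (simp add: eq_diff_eq add.commute)
  have commute: "T * Y = Y * T" if "T * A = A * T" for T
  proof -
    have TX: "T * X = X * T" using that by (simp add: X_def algebra_simps)
    have "T * sqrt_iter X n = sqrt_iter X n * T" for n
    proof (induction n)
      case (Suc n)
      have "T * (sqrt_iter X n * sqrt_iter X n) = sqrt_iter X n * sqrt_iter X n * T"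
        using Suc by (metis mult.assoc)
      then show ?case by (simp add: distrib_left distrib_right TX)
    qed simp
    then have "(\<lambda>n. T * sqrt_iter X n) \<longlonglongrightarrow> Y * T"
      by (simp add: tendsto_mult[OF Y tendsto_const])
    then show ?thesis by (rule LIMSEQ_unique[OF tendsto_mult[OF tendsto_const Y]])
  qed
  have star_Y: "star Y = Y"
  proof (rule star_eqI_inner)
    have starX: "star X = X" by (simp add: X_def star_diff star_scaleR star_I A)
    have "star (sqrt_iter X n) = sqrt_iter X n" for n
      by (induction n) (simp_all add: star_scaleR star_add star_mult starX)
    then have s: "inner (bop_apply (sqrt_iter X n) x) y = inner x (bop_apply (sqrt_iter X n) y)" for n x y
      using inner_star by metis
    have lim: "(\<lambda>n. bop_apply (sqrt_iter X n) x) \<longlonglongrightarrow> bop_apply Y x" for x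
    proof (rule LIM_zero_cancel, rule Lim_null_comparison)
      show "\<forall>\<^sub>F n in sequentially. norm (bop_apply (sqrt_iter X n) x - bop_apply Y x)
          \<le> norm (sqrt_iter X n - Y) * norm x"
        by (metis (no_types, lifting) always_eventually bop_apply_simps(2) norm_bop_apply)
      show "(\<lambda>n. norm (sqrt_iter X n - Y) * norm x) \<longlonglongrightarrow> 0"
        by (intro tendsto_mult_left_zero tendsto_norm_zero LIM_zero Y)
    qed
    show "inner (bop_apply Y x) y = inner x (bop_apply Y y)" for x y
      by (rule LIMSEQ_unique[OF tendsto_inner[OF lim tendsto_const]])
        (unfold s, rule tendsto_inner[OF tendsto_const lim])
  qed
  define S where "S = sqrt c *\<^sub>R (I - Y)"
  show thesis
  proof
    show "star S = S" by (simp add: S_def star_scaleR star_diff star_I star_Y)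
    have "(I - Y) * (I - Y) = I - 2 *\<^sub>R Y + Y * Y"
      by (simp add: left_diff_distrib right_diff_distrib scaleR_2)
    also have "\<dots> = (1 / c) *\<^sub>R A" by (simp add: Y_sq X_def)
    finally show "S * S = A" using c by (simp add: S_def)
    show "T * S = S * T" if "T * A = A * T" for T
      using commute[OF that] by (simp add: S_def left_diff_distrib right_diff_distrib)
  qed
qed

subsection \<open>Intertwiners\<close>

lemma closure_induct:
  assumes "x \<in> closure A" "closed {x. P x}" "\<And>x. x \<in> A \<Longrightarrow> P x"
  shows "P x"
  using closure_minimal[of A "{x. P x}"] assms by blast

lemma closure_image_mem:
  assumes "x \<in> closure A" "continuous_on UNIV f" "\<And>x. x \<in> A \<Longrightarrow> f x \<in> B"
  shows "f x \<in> closure B"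
  using assms(1)
proof (rule closure_induct)
  show "closed {x. f x \<in> closure B}"
    using closed_vimage[OF closed_closure assms(2)] by (simp add: vimage_def)
qed (use assms(3) closure_subset in blast)

lemma csubspace_image:
  assumes f: "bounded_clinear f" and S: "csubspace S" shows "csubspace (f ` S)"
proof (rule complex_vector.subspaceI)
  show "0 \<in> f ` S" using bounded_clinear_zero[OF f] complex_vector.subspace_0[OF S] by (metis imageI)
  show "x + y \<in> f ` S" if "x \<in> f ` S" "y \<in> f ` S" for x y
    using that by (auto simp flip: bounded_clinear_add[OF f] intro!: imageI complex_vector.subspace_add[OF S])
  show "c *\<^sub>C x \<in> f ` S" if "x \<in> f ` S" for c x
    using that by (auto simp flip: bounded_clinear_scaleC[OF f] intro!: imageI complex_vector.subspace_scale[OF S])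
qed

lemma csubspace_range: "bounded_clinear f \<Longrightarrow> csubspace (range f)"
  by (rule csubspace_image[OF _ complex_vector.subspace_UNIV])

lemma bounded_graph_extension:
  fixes G :: "('b::complex_hilbert \<times> 'c::complex_hilbert) set"
  assumes G: "csubspace G" and M: "0 \<le> M"
    and le: "\<And>x y. (x, y) \<in> G \<Longrightarrow> norm y \<le> M * norm x"
  obtains C where "bounded_clinear C" "\<And>x y. (x, y) \<in> G \<Longrightarrow> C x = y"
    "\<And>x. C x \<in> closure (snd ` G)" "\<And>x. C (bop_apply (proj (closure (fst ` G))) x) = C x"
    "\<And>x. norm (C x) \<le> M * norm x"
proof -
  define D where "D = closure G"
  have D: "csubspace D" unfolding D_def by (rule csubspace_closure[OF G])
  have D_le: "norm y \<le> M * norm x" if "(x, y) \<in> D" for x y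
  proof -
    have "norm (snd z) \<le> M * norm (fst z)" if "z \<in> closure G" for z
      using that by (rule closure_induct)
        (auto intro!: closed_Collect_le continuous_intros le)
    from this[OF that[unfolded D_def]] show ?thesis by simp
  qed
  define K where "K = closure (fst ` G)"
  have K: "csubspace K" "closed K"
    unfolding K_def by (intro csubspace_closure csubspace_image bounded_clinear_fst G closed_closure)+
  have ex: "\<exists>y. (x, y) \<in> D" if "x \<in> K" for x
  proof -
    obtain X where X: "\<forall>n. X n \<in> fst ` G" "X \<longlonglongrightarrow> x"
      using \<open>x \<in> K\<close> unfolding K_def closure_sequential by blast
    then have "\<forall>n. \<exists>y. (X n, y) \<in> G" by force
    then obtain Y where Y: "\<And>n. (X n, Y n) \<in> G" by metis
    have YX: "dist (Y m) (Y n) \<le> M * dist (X m) (X n)" for m n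
      using le[of "X m - X n" "Y m - Y n"] complex_vector.subspace_diff[OF G Y[of m] Y[of n]]
      by (simp add: dist_norm)
    have "Cauchy Y"
    proof (rule metric_CauchyI)
      fix e :: real assume "e > 0"
      \<comment> \<open>Dividing by \<open>M + 1\<close> covers the case
        \<open>M = 0\<close>.\<close>
      then have "e / (M + 1) > 0" using M by (simp add: add_nonneg_pos)
      then obtain N where N: "\<And>m n. m \<ge> N \<Longrightarrow> n \<ge> N \<Longrightarrow> dist (X m) (X n) < e / (M + 1)"
        using LIMSEQ_imp_Cauchy[OF X(2)] unfolding Cauchy_def by meson
      have "dist (Y m) (Y n) < e" if "m \<ge> N" "n \<ge> N" for m n
      proof -
        have "dist (Y m) (Y n) \<le> (M + 1) * dist (X m) (X n)"
          by (rule order_trans[OF YX mult_right_mono]) auto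
        also have "\<dots> < e" using N[OF that] M by (simp add: field_simps add_nonneg_pos)
        finally show ?thesis .
      qed
      then show "\<exists>N. \<forall>m\<ge>N. \<forall>n\<ge>N. dist (Y m) (Y n) < e" by blast
    qed
    then obtain y where "Y \<longlonglongrightarrow> y" using Cauchy_convergent convergent_def by blast
    then have "(\<lambda>n. (X n, Y n)) \<longlonglongrightarrow> (x, y)" by (intro tendsto_Pair X)
    then have "(x, y) \<in> D" unfolding D_def closure_sequential
      by (intro exI[of _ "\<lambda>n. (X n, Y n)"]) (simp add: Y)
    then show ?thesis by blast
  qed
  define C where "C x = (THE y. (bop_apply (proj K) x, y) \<in> D)" for x
  have uniq: "y = z" if "(x, y) \<in> D" "(x, z) \<in> D" for x y z
    using D_le[of 0 "y - z"] complex_vector.subspace_diff[OF D that] by simp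
  have CD: "(bop_apply (proj K) x, C x) \<in> D" for x
    unfolding C_def by (rule theI') (use ex[OF proj_in[OF K]] uniq in blast)
  have C_eq: "C x = y" if "(bop_apply (proj K) x, y) \<in> D" for x y
    using uniq CD that by blast
  have C_le: "norm (C x) \<le> M * norm x" for x
    by (rule order_trans[OF D_le[OF CD] mult_left_mono[OF norm_proj_le[OF K] M]])
  show thesis
  proof (rule that)
    show "bounded_clinear C"
    proof (rule bounded_clinearI[OF _ _ C_le])
      show "C (x + y) = C x + C y" for x y
        using complex_vector.subspace_add[OF D CD[of x] CD[of y]]
        by (intro C_eq) (simp add: bop_apply_add)
      show "C (c *\<^sub>C x) = c *\<^sub>C C x" for c x
        using complex_vector.subspace_scale[OF D CD[of x], of c]
        by (intro C_eq) (simp add: bop_apply_scaleC scaleC_prod_def)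
    qed
    show "C x = y" if "(x, y) \<in> G" for x y
    proof -
      have "x \<in> K" unfolding K_def using that closure_subset by force
      then show ?thesis using that closure_subset[of G]
        by (intro C_eq) (auto simp: proj_ident[OF K] D_def)
    qed
    show "C x \<in> closure (snd ` G)" for x
      using closure_image_mem[OF CD[of x, unfolded D_def], of snd "snd ` G"]
      by (simp add: continuous_on_snd)
    show "C (bop_apply (proj (closure (fst ` G))) x) = C x" for x
      unfolding K_def[symmetric] by (rule C_eq) (simp add: proj_proj[OF K] CD)
  qed (rule C_le)
qed

text \<open>Polarization of \<open>norm (U (x + y))\<close> yields the real part; replacing
  \<open>y\<close> by \<open>(- \<i>) *\<^sub>C y\<close> yields the imaginary part.\<close>

lemma isometric_imp_cinner_eq:
  fixes U :: "'b::complex_hilbert \<Rightarrow> 'c::complex_hilbert"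
  assumes U: "bounded_clinear U" and K: "csubspace K" and iso: "\<And>x. x \<in> K \<Longrightarrow> norm (U x) = norm x"
    and x: "x \<in> K" and y: "y \<in> K"
  shows "cinner (U x) (U y) = cinner x y"
proof -
  have inner_eq: "inner (U x) (U y) = inner x y" if y: "y \<in> K" for y
  proof -
    have "(norm (U x + U y))\<^sup>2 = (norm (x + y))\<^sup>2"
      using iso[OF complex_vector.subspace_add[OF K x y]] by (simp add: bounded_clinear_add[OF U])
    moreover have "(norm (U x))\<^sup>2 = (norm x)\<^sup>2" "(norm (U y))\<^sup>2 = (norm y)\<^sup>2" using iso x y by simp_all
    ultimately show ?thesis
      by (simp add: power2_norm_eq_inner inner_add_left inner_add_right inner_commute)
  qed
  have im: "Im (cinner u v) = inner u ((- \<i>) *\<^sub>C v)" for u v :: "'d::complex_hilbert"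
    by (simp only: Re_cinner[symmetric] cinner_scaleC_right) simp
  show ?thesis
  proof (rule complex_eqI)
    show "Re (cinner (U x) (U y)) = Re (cinner x y)" using inner_eq[OF y] by (simp add: Re_cinner)
    show "Im (cinner (U x) (U y)) = Im (cinner x y)"
      unfolding im using inner_eq[OF complex_vector.subspace_scale[OF K y, of "- \<i>"]]
      by (simp only: bounded_clinear_scaleC[OF U])
  qed
qed

text \<open>The operators of a representation act on the whole type with range in its space, and so
  do their adjoints. Multiplying by \<open>proj K\<close> makes them vanish off \<open>K\<close>, as
  this convention demands of a representation on \<open>K\<close>.\<close>

definition restrict_rep :: "('m, 'l::complex_hilbert) rep \<Rightarrow> 'l set \<Rightarrow> ('m, 'l) rep"
  where "restrict_rep \<pi> K = \<lparr>rep_space = K, rep_op = (\<lambda>a. rep_op \<pi> a * proj K)\<rparr>"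

lemma restrict_rep_simps [simp]:
  "rep_space (restrict_rep \<pi> K) = K"
  "bop_apply (rep_op (restrict_rep \<pi> K) a) x = bop_apply (rep_op \<pi> a) (bop_apply (proj K) x)"
  by (simp_all add: restrict_rep_def bop_apply_times)

context
  fixes \<pi> :: "('m::cstar_algebra, 'l::complex_hilbert) rep"
  assumes \<pi>: "representation \<pi>"
begin

lemma rep_csubspace: "csubspace (rep_space \<pi>)"
  and rep_closed: "closed (rep_space \<pi>)"
  and rep_in: "bop_apply (rep_op \<pi> a) x \<in> rep_space \<pi>"
  and rep_clinear: "clinear (rep_op \<pi>)"
  and rep_mult: "bop_apply (rep_op \<pi> (a * b)) x = bop_apply (rep_op \<pi> a) (bop_apply (rep_op \<pi> b) x)"
  and rep_star: "rep_op \<pi> (star a) = star (rep_op \<pi> a)"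
  using \<pi> by (simp_all add: representation_def bop_apply_times)

lemma cinner_rep: "cinner (bop_apply (rep_op \<pi> a) x) y = cinner x (bop_apply (rep_op \<pi> (star a)) y)"
  by (simp add: rep_star cinner_star_bop')

text \<open>The operator and its adjoint, which represents \<open>star a\<close>, both have range in
  the space, so \<open>proj_commute\<close> applies and the outer projection disappears.\<close>

lemma rep_proj: "bop_apply (rep_op \<pi> a) (bop_apply (proj (rep_space \<pi>)) x) = bop_apply (rep_op \<pi> a) x"
  by (metis proj_commute[OF rep_csubspace rep_closed] proj_ident[OF rep_csubspace rep_closed]
      rep_in rep_star)

context
  fixes K :: "'l set"
  assumes K: "csubspace K" "closed K"
    and invariant: "\<And>a x. x \<in> K \<Longrightarrow> bop_apply (rep_op \<pi> a) x \<in> K"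
begin

lemma rep_proj_commute:
  "bop_apply (proj K) (bop_apply (rep_op \<pi> a) x) = bop_apply (rep_op \<pi> a) (bop_apply (proj K) x)"
  by (rule proj_commute[OF K]) (simp_all add: invariant flip: rep_star)

lemma representation_restrict_rep: "representation (restrict_rep \<pi> K)"
  unfolding representation_def
proof (intro conjI allI)
  show "bop_apply (rep_op (restrict_rep \<pi> K) a) x \<in> rep_space (restrict_rep \<pi> K)" for a x
    by (simp add: invariant proj_in[OF K])
  have "clinear (\<lambda>a. rep_op \<pi> a * proj K)"
    using rep_clinear by (simp add: clinear_iff distrib_right scaleC_mult_left)
  then show "clinear (rep_op (restrict_rep \<pi> K))" by (simp add: restrict_rep_def)
  show "rep_op (restrict_rep \<pi> K) (a * b) = rep_op (restrict_rep \<pi> K) a * rep_op (restrict_rep \<pi> K) b" for a b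
    by (rule bop_eqI) (simp add: bop_apply_times rep_mult rep_proj_commute proj_proj[OF K])
  show "rep_op (restrict_rep \<pi> K) (star a) = star (rep_op (restrict_rep \<pi> K) a)" for a
    by (rule bop_eqI)
      (simp add: restrict_rep_def star_mult star_proj[OF K] bop_apply_times rep_proj_commute flip: rep_star)
qed (use K in simp_all)

end

text \<open>The orthogonal complement \<open>M\<close> of \<open>K\<close> within the space is
  invariant because \<open>proj K\<close> commutes with the representation. Splitting a vector into
  its components in \<open>K\<close> and \<open>M\<close> is the required unitary, and both summands
  stay on the original type.\<close>

lemma subrepresentation_restrict_rep:
  assumes K: "csubspace K" "closed K"
    and invariant: "\<And>a x. x \<in> K \<Longrightarrow> bop_apply (rep_op \<pi> a) x \<in> K"
    and sub: "K \<subseteq> rep_space \<pi>"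
  shows "subrepresentation (restrict_rep \<pi> K) \<pi>"
proof -
  define M where "M = rep_space \<pi> \<inter> {x. bop_apply (proj K) x = 0}"
  have M: "csubspace M" "closed M"
  proof -
    show "csubspace M" unfolding M_def
      by (intro complex_vector.subspace_inter rep_csubspace complex_vector.subspaceI)
        (simp_all add: bop_apply_add bop_apply_scaleC)
    show "closed M" unfolding M_def
      by (intro closed_Int rep_closed closed_Collect_eq continuous_bop_apply continuous_on_const)
  qed
  note comm = rep_proj_commute[OF K invariant]
  have M_inv: "bop_apply (rep_op \<pi> a) x \<in> M" if "x \<in> M" for a x
    using that by (simp add: M_def rep_in comm)
  define U where "U x = (bop_apply (proj K) x, x - bop_apply (proj K) x)" for x
  have U_M: "x - bop_apply (proj K) x \<in> M" if "x \<in> rep_space \<pi>" for x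
    using that proj_in[OF K, of x] sub complex_vector.subspace_diff[OF rep_csubspace]
    by (auto simp: M_def bop_apply_diff proj_proj[OF K])
  have "rep_equivalent \<pi> (rep_sum (restrict_rep \<pi> K) (restrict_rep \<pi> M))"
    unfolding rep_equivalent_def unitary_between_def
  proof (intro exI[of _ U] conjI allI ballI)
    show "U ` rep_space \<pi> = rep_space (rep_sum (restrict_rep \<pi> K) (restrict_rep \<pi> M))"
    proof (intro equalityI subsetI)
      fix z assume "z \<in> rep_space (rep_sum (restrict_rep \<pi> K) (restrict_rep \<pi> M))"
      then obtain k m where z: "z = (k, m)" "k \<in> K" "m \<in> M" by (auto simp: rep_sum_def)
      then have "U (k + m) = z"
        by (simp add: U_def bop_apply_add proj_ident[OF K] M_def)
      moreover have "k + m \<in> rep_space \<pi>"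
        using z sub by (intro complex_vector.subspace_add[OF rep_csubspace]) (auto simp: M_def)
      ultimately show "z \<in> U ` rep_space \<pi>" by blast
    qed (auto simp: U_def rep_sum_def proj_in[OF K] U_M)
    show "U (x + y) = U x + U y" for x y by (simp add: U_def bop_apply_add)
    show "U (c *\<^sub>C x) = c *\<^sub>C U x" for c x
      by (simp add: U_def bop_apply_scaleC scaleC_prod_def scaleC_diff_right)
    show "cinner (U x) (U y) = cinner x y" for x y
      by (simp add: U_def cinner_prod_def cinner_diff_left cinner_diff_right
          cinner_proj_selfadjoint[OF K] proj_proj[OF K])
    show "U (bop_apply (rep_op \<pi> a) x) = bop_apply (rep_op (rep_sum (restrict_rep \<pi> K) (restrict_rep \<pi> M)) a) (U x)"
      if "x \<in> rep_space \<pi>" for a x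
      using proj_ident[OF M U_M[OF that]]
      by (simp add: U_def rep_sum_def bop_apply_bop_sum proj_proj[OF K] comm flip: bop_apply_diff)
  qed
  then show ?thesis
    using \<pi> representation_restrict_rep[OF K invariant] representation_restrict_rep[OF M M_inv]
    unfolding subrepresentation_def by blast
qed

end

text \<open>With \<open>T = C\<^sup>* C\<close> and \<open>S\<close> a self-adjoint square root of
  \<open>T\<close>, the norms of \<open>bop_apply S x\<close> and \<open>C x\<close> agree. Hence
  \<open>C x \<mapsto> bop_apply S x\<close> extends to a unitary from the closed range of
  \<open>C\<close>, inside \<open>\<sigma>\<close>, to that of \<open>S\<close>, inside
  \<open>\<rho>\<close>. It intertwines because \<open>T\<close>, and with it \<open>S\<close>,
  commutes with \<open>\<rho>\<close>.\<close>

lemma totally_orthogonal_intertwiner_eq_zero: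
  fixes \<sigma> :: "('m::cstar_algebra, 'k::complex_hilbert) rep" and \<rho> :: "('m, 'l::complex_hilbert) rep"
  assumes \<sigma>: "representation \<sigma>" and \<rho>: "representation \<rho>" and C: "bounded_clinear C"
    and intertwines: "\<And>a x. C (bop_apply (rep_op \<rho> a) x) = bop_apply (rep_op \<sigma> a) (C x)"
    and C_in: "\<And>x. C x \<in> rep_space \<sigma>"
    and C_proj: "\<And>x. C (bop_apply (proj (rep_space \<rho>)) x) = C x"
    and orth: "totally_orthogonal \<sigma> \<rho>"
  shows "C x = 0"
proof (rule ccontr)
  assume nonzero: "C x \<noteq> 0"
  note C_add = bounded_clinear_add[OF C] and C_scale = bounded_clinear_scaleC[OF C]
  obtain T where T: "bop_apply T = (\<lambda>x. cadjoint C (C x))"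
    by (rule bop_of_bounded_clinear[OF bounded_clinear_compose[OF bounded_clinear_cadjoint[OF C] C]])
  have T_right: "cinner x (bop_apply T y) = cinner (C x) (C y)" for x y
    by (simp add: T cinner_cadjoint'[OF C])
  have T_left: "cinner (bop_apply T x) y = cinner (C x) (C y)" for x y
    by (simp add: T cinner_cadjoint[OF C])
  have "star T = T" by (rule bop_eqI_cinner) (simp add: cinner_star_bop' T_left T_right)
  moreover have "0 \<le> inner x (bop_apply T x)" for x
    by (simp only: Re_cinner[symmetric] T_right) (simp add: Re_cinner)
  ultimately obtain S where star_S: "star S = S" and SS: "S * S = T"
    and S_comm: "\<And>R. R * T = T * R \<Longrightarrow> R * S = S * R"
    by (rule bop_sqrt_exists) blast
  have "cinner (bop_apply S x) (bop_apply S y) = cinner (C x) (C y)" for x y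
    by (metis SS T_right bop_apply_times cinner_star_bop star_S)
  then have norm_S: "norm (bop_apply S x) = norm (C x)" for x by (rule norm_eq_of_cinner_eq)
  have rho_S: "bop_apply S (bop_apply (rep_op \<rho> a) x) = bop_apply (rep_op \<rho> a) (bop_apply S x)" for a x
  proof -
    have "rep_op \<rho> a * T = T * rep_op \<rho> a"
    proof (rule bop_eqI_cinner)
      fix x y
      have "cinner x (bop_apply (rep_op \<rho> a * T) y) = cinner (bop_apply (rep_op \<rho> (star a)) x) (bop_apply T y)"
        by (simp add: bop_apply_times cinner_rep[OF \<rho>] star_star)
      also have "\<dots> = cinner x (bop_apply (T * rep_op \<rho> a) y)"
        by (simp add: bop_apply_times T_right intertwines cinner_rep[OF \<sigma>] star_star)
      finally show "cinner x (bop_apply (rep_op \<rho> a * T) y) = cinner x (bop_apply (T * rep_op \<rho> a) y)" .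
    qed
    then show ?thesis by (metis S_comm bop_apply_times)
  qed
  let ?P = "proj (rep_space \<rho>)"
  note L = rep_csubspace[OF \<rho>] rep_closed[OF \<rho>]
  have S_in: "bop_apply S x \<in> rep_space \<rho>" for x
  proof -
    have "?P * T = T * ?P"
    proof (rule bop_eqI_cinner)
      fix x y
      have "cinner x (bop_apply (?P * T) y) = cinner (bop_apply ?P x) (bop_apply T y)"
        using cinner_star_bop[of ?P x "bop_apply T y"] by (simp add: bop_apply_times star_proj[OF L])
      then show "cinner x (bop_apply (?P * T) y) = cinner x (bop_apply (T * ?P) y)"
        by (simp add: bop_apply_times T_right C_proj)
    qed
    then have "bop_apply ?P (bop_apply S x) = bop_apply S (bop_apply ?P x)"
      by (metis S_comm bop_apply_times)
    \<comment> \<open>\<open>C\<close> vanishes on the orthogonal complement of the space of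
      \<open>\<rho>\<close>, hence so does \<open>S\<close>. Together with commutation this puts the
      range of \<open>S\<close> into that space.\<close>
    moreover have "norm (bop_apply S (x - bop_apply ?P x)) = 0"
      unfolding norm_S by (simp add: bounded_clinear_diff[OF C] C_proj)
    ultimately have "bop_apply S x = bop_apply ?P (bop_apply S x)" by (simp add: bop_apply_diff)
    then show ?thesis using proj_in[OF L] by metis
  qed
  define K where "K = closure (range C)"
  define M where "M = closure (range (bop_apply S))"
  have K: "csubspace K" "closed K"
    unfolding K_def by (simp_all add: csubspace_closure csubspace_range C)
  have M: "csubspace M" "closed M"
    unfolding M_def by (simp_all add: csubspace_closure csubspace_range bounded_clinear_bop_apply)
  have K_inv: "bop_apply (rep_op \<sigma> a) x \<in> K" if "x \<in> K" for a x
    using that unfolding K_def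
    by (rule closure_image_mem[OF _ continuous_bop_apply]) (auto simp flip: intertwines)
  have M_inv: "bop_apply (rep_op \<rho> a) x \<in> M" if "x \<in> M" for a x
    using that unfolding M_def
    by (rule closure_image_mem[OF _ continuous_bop_apply]) (auto simp flip: rho_S)
  have K_sub: "K \<subseteq> rep_space \<sigma>"
    unfolding K_def by (intro closure_minimal rep_closed[OF \<sigma>]) (use C_in in blast)
  have M_sub: "M \<subseteq> rep_space \<rho>"
    unfolding M_def by (intro closure_minimal rep_closed[OF \<rho>]) (use S_in in blast)
  have graph1: "csubspace (range (\<lambda>x. (C x, bop_apply S x)))"
    by (intro csubspace_range bounded_clinear_Pair C bounded_clinear_bop_apply)
  obtain U where U: "bounded_clinear U" and UC: "\<And>x. U (C x) = bop_apply S x"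
    and U_in: "\<And>x. U x \<in> M"
    by (rule bounded_graph_extension[OF graph1, where M = 1])
      (auto simp: norm_S M_def image_image)
  \<comment> \<open>The isometry \<open>W\<close> in the opposite direction serves to show that
    \<open>U\<close> maps \<open>K\<close> onto all of \<open>M\<close>.\<close>
  have graph2: "csubspace (range (\<lambda>x. (bop_apply S x, C x)))"
    by (intro csubspace_range bounded_clinear_Pair C bounded_clinear_bop_apply)
  obtain W where W: "bounded_clinear W" and WS: "\<And>x. W (bop_apply S x) = C x"
    and W_in: "\<And>x. W x \<in> K"
    by (rule bounded_graph_extension[OF graph2, where M = 1])
      (auto simp: norm_S K_def image_image)
  have UW: "U (W y) = y" if "y \<in> M" for y
    using that unfolding M_def
    by (rule closure_induct)
      (auto simp: WS UC intro!: closed_Collect_eq continuous_bounded_clinear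
        bounded_clinear_compose[OF U W] bounded_clinear_ident)
  have U_norm: "norm (U z) = norm z" if "z \<in> K" for z
    using that unfolding K_def
    by (rule closure_induct)
      (auto simp: UC norm_S intro!: closed_Collect_eq continuous_on_norm continuous_bounded_clinear
        U bounded_clinear_ident)
  have U_inter: "U (bop_apply (rep_op \<sigma> a) z) = bop_apply (rep_op \<rho> a) (U z)" if "z \<in> K" for a z
    using that unfolding K_def
  proof (rule closure_induct)
    show "closed {z. U (bop_apply (rep_op \<sigma> a) z) = bop_apply (rep_op \<rho> a) (U z)}"
      by (intro closed_Collect_eq continuous_bounded_clinear bounded_clinear_compose[OF U]
          bounded_clinear_compose[OF bounded_clinear_bop_apply U] bounded_clinear_bop_apply)
    show "U (bop_apply (rep_op \<sigma> a) z) = bop_apply (rep_op \<rho> a) (U z)" if "z \<in> range C" for z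
      using that by (auto simp: UC rho_S simp flip: intertwines)
  qed
  have "rep_equivalent (restrict_rep \<sigma> K) (restrict_rep \<rho> M)"
    unfolding rep_equivalent_def unitary_between_def
  proof (intro exI[of _ U] conjI allI ballI)
    show "U ` rep_space (restrict_rep \<sigma> K) = rep_space (restrict_rep \<rho> M)"
      unfolding restrict_rep_simps
    proof (intro equalityI subsetI)
      show "y \<in> U ` K" if "y \<in> M" for y using imageI[OF W_in[of y], of U] UW[OF that] by simp
    qed (use U_in in blast)
    show "U (x + y) = U x + U y" "U (c *\<^sub>C x) = c *\<^sub>C U x" for c x y
      by (simp_all add: bounded_clinear_add[OF U] bounded_clinear_scaleC[OF U])
    show "cinner (U x) (U y) = cinner x y"
      if "x \<in> rep_space (restrict_rep \<sigma> K)" "y \<in> rep_space (restrict_rep \<sigma> K)" for x y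
      using isometric_imp_cinner_eq[OF U K(1) U_norm] that by simp
    show "U (bop_apply (rep_op (restrict_rep \<sigma> K) a) x) = bop_apply (rep_op (restrict_rep \<rho> M) a) (U x)"
      if "x \<in> rep_space (restrict_rep \<sigma> K)" for a x
      using that by (simp add: proj_ident[OF K] proj_ident[OF M U_in] U_inter)
  qed
  moreover have "rep_space (restrict_rep \<sigma> K) \<noteq> {0}"
  proof -
    have "C x \<in> K" unfolding K_def by (rule subsetD[OF closure_subset]) (rule rangeI)
    then show ?thesis unfolding restrict_rep_simps using nonzero by (metis singletonD)
  qed
  moreover note subrepresentation_restrict_rep[OF \<sigma> K K_inv K_sub]
    subrepresentation_restrict_rep[OF \<rho> M M_inv M_sub]
  ultimately show False
    using orth[unfolded totally_orthogonal_def, rule_format] by (meson)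
qed

subsection \<open>Complete positivity from positive forms\<close>

text \<open>A factorization in the style of Douglas: the bound makes
  \<open>bop_apply S x \<mapsto> bop_apply (star B) x\<close> a bounded map \<open>C\<close> with
  \<open>C * S = star B\<close>, and taking adjoints gives \<open>S * star C = B\<close>. As
  \<open>C\<close> vanishes on the orthogonal complement of the range of \<open>S\<close>, the range
  of \<open>star C\<close> lies in the closure of that range.\<close>

lemma bop_factor_through_selfadjoint:
  fixes S B :: "'h::complex_hilbert bop"
  assumes S: "star S = S" and M: "0 \<le> M" and le: "\<And>x. norm (bop_apply (star B) x) \<le> M * norm (bop_apply S x)"
  obtains G where "S * G = B" "\<And>y. bop_apply G y \<in> closure (range (bop_apply S))"
proof -
  let ?K = "closure (range (bop_apply S))"
  have K: "csubspace ?K" "closed ?K"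
    by (simp_all add: csubspace_closure csubspace_range bounded_clinear_bop_apply)
  have graph: "csubspace (range (\<lambda>x. (bop_apply S x, bop_apply (star B) x)))"
    by (intro csubspace_range bounded_clinear_Pair bounded_clinear_bop_apply)
  obtain c where c: "bounded_clinear c" and c_S: "\<And>x. c (bop_apply S x) = bop_apply (star B) x"
    and c_proj: "\<And>x. c (bop_apply (proj ?K) x) = c x"
    by (rule bounded_graph_extension[OF graph M]) (auto simp: le image_image)
  obtain C where C: "bop_apply C = c" by (rule bop_of_bounded_clinear[OF c])
  have CS: "C * S = star B" by (rule bop_eqI) (simp add: bop_apply_times C c_S)
  show thesis
  proof
    have "S * star C = star (C * S)" by (simp add: star_mult S)
    then show "S * star C = B" by (simp add: CS star_star)
    show "bop_apply (star C) y \<in> ?K" for y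
    proof -
      have "bop_apply (proj ?K) (bop_apply (star C) y) = bop_apply (star C) y"
      proof (rule cinner_eqI)
        fix z
        have "cinner (bop_apply (proj ?K) (bop_apply (star C) y)) z = cinner (bop_apply (star C) y) (bop_apply (proj ?K) z)"
          using cinner_star_bop[of "proj ?K" "bop_apply (star C) y" z] by (simp add: star_proj[OF K])
        then show "cinner (bop_apply (proj ?K) (bop_apply (star C) y)) z = cinner (bop_apply (star C) y) z"
          by (simp add: cinner_star_bop C c_proj)
      qed
      then show ?thesis using proj_in[OF K] by metis
    qed
  qed
qed

text \<open>
  Cholesky factorization of a positive operator matrix, eliminating the last row and column in each
  step.
\<close>

lemma operator_matrix_factorization:
  fixes X :: "nat \<Rightarrow> nat \<Rightarrow> 'h::complex_hilbert bop"
  assumes "\<And>i j. i < n \<Longrightarrow> j < n \<Longrightarrow> star (X i j) = X j i"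
    and "\<And>h. 0 \<le> (\<Sum>i<n. \<Sum>j<n. inner (h i) (bop_apply (X i j) (h j)))"
  shows "\<exists>Z. \<forall>i<n. \<forall>j<n. X i j = (\<Sum>k<n. star (Z k i) * Z k j)"
  using assms
proof (induction n arbitrary: X)
  case (Suc n)
  have star_X: "star (X i j) = X j i" if "i < Suc n" "j < Suc n" for i j using Suc.prems(1) that .
  have X_adj: "inner x (bop_apply (X i j) y) = inner (bop_apply (X j i) x) y"
    if "i < Suc n" "j < Suc n" for i j x y
    using inner_star'[of x "X j i" y] star_X[of j i] that by simp
  define F where "F h = (\<Sum>i<n. \<Sum>j<n. inner (h i) (bop_apply (X i j) (h j)))" for h
  \<comment> \<open>This is the form of size \<open>Suc n\<close> at the family \<open>h\<close>
    with \<open>x\<close> in the last place. The two mixed sums agree because the matrix is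
    self-adjoint, whence the factor 2.\<close>
  have F0: "0 \<le> F h + 2 * inner x (\<Sum>j<n. bop_apply (X n j) (h j)) + inner x (bop_apply (X n n) x)" for h x
  proof -
    define h' where "h' i = (if i = n then x else h i)" for i
    have h': "h' n = x" "\<And>i. i < n \<Longrightarrow> h' i = h i" by (simp_all add: h'_def)
    have split: "(\<Sum>i<Suc n. \<Sum>j<Suc n. f i j)
        = (\<Sum>i<n. \<Sum>j<n. f i j) + (\<Sum>i<n. f i n) + (\<Sum>j<n. f n j) + f n n" for f :: "nat \<Rightarrow> nat \<Rightarrow> real"
      by (simp add: sum.distrib)
    have "(\<Sum>i<n. \<Sum>j<n. inner (h' i) (bop_apply (X i j) (h' j))) = F h"
      unfolding F_def by (intro sum.cong refl) (simp add: h')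
    moreover have "(\<Sum>i<n. inner (h' i) (bop_apply (X i n) (h' n))) = (\<Sum>i<n. inner (h i) (bop_apply (X i n) x))"
      "(\<Sum>j<n. inner (h' n) (bop_apply (X n j) (h' j))) = (\<Sum>j<n. inner x (bop_apply (X n j) (h j)))"
      by (intro sum.cong refl; simp add: h')+
    ultimately have "(\<Sum>i<Suc n. \<Sum>j<Suc n. inner (h' i) (bop_apply (X i j) (h' j)))
        = F h + (\<Sum>i<n. inner (h i) (bop_apply (X i n) x)) + (\<Sum>j<n. inner x (bop_apply (X n j) (h j)))
          + inner x (bop_apply (X n n) x)"
      by (simp only: split h'(1))
    moreover have "(\<Sum>i<n. inner (h i) (bop_apply (X i n) x)) = (\<Sum>j<n. inner x (bop_apply (X n j) (h j)))"
      using X_adj[of _ n] by (intro sum.cong refl) (simp add: inner_commute)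
    ultimately show ?thesis using Suc.prems(2)[of h'] by (simp add: inner_sum_right)
  qed
  have "star (X n n) = X n n" by (rule star_X) simp_all
  moreover have "0 \<le> inner x (bop_apply (X n n) x)" for x using F0[of "\<lambda>_. 0" x] by (simp add: F_def)
  ultimately obtain S where S: "star S = S" and SS: "S * S = X n n"
    by (rule bop_sqrt_exists) blast
  have S_adj: "inner x (bop_apply S y) = inner (bop_apply S x) y" for x y
    using inner_star'[of x S y] by (simp add: S)
  have XS: "inner x (bop_apply (X n n) x) = (norm (bop_apply S x))\<^sup>2" for x
    by (simp add: bop_apply_times S_adj power2_norm_eq_inner flip: SS)
  have "\<exists>G. S * G = X n j \<and> (\<forall>y. bop_apply G y \<in> closure (range (bop_apply S)))" if j: "j < n" for j
  proof -
    define d where "d = norm (X j j) + 1"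
    have d: "d > 0" by (simp add: d_def add_nonneg_pos)
    have "norm (bop_apply (star (X n j)) x) \<le> sqrt d * norm (bop_apply S x)" for x
    proof (rule power2_le_imp_le)
      define b where "b = bop_apply (star (X n j)) x"
      \<comment> \<open>With \<open>y\<close> in place \<open>j\<close> and zeros elsewhere,
        \<open>F h\<close> is at most \<open>(norm b)\<^sup>2 / d\<close> while the mixed term in
        \<open>F0\<close> equals \<open>- 2 * (norm b)\<^sup>2 / d\<close>. What remains is the
        bound of \<open>b\<close> by \<open>bop_apply S x\<close>.\<close>
      define y where "y = (- (1 / d)) *\<^sub>R b"
      define h where "h i = (if i = j then y else 0)" for i
      have "inner (h i) (bop_apply (X i k) (h k))
          = (if k = j then if i = j then inner y (bop_apply (X j j) y) else 0 else 0)" for i k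
        by (simp add: h_def)
      then have "F h = inner y (bop_apply (X j j) y)" using j by (simp add: F_def)
      also have "\<dots> \<le> norm y * (norm (X j j) * norm y)"
        by (rule order_trans[OF norm_cauchy_schwarz mult_left_mono[OF norm_bop_apply]]) simp
      also have "\<dots> \<le> d * (norm y)\<^sup>2" by (simp add: d_def power2_eq_square algebra_simps)
      also have "\<dots> = (norm b)\<^sup>2 / d" using d by (simp add: y_def power_mult_distrib power2_eq_square field_simps)
      finally have Fh: "F h \<le> (norm b)\<^sup>2 / d" .
      have "bop_apply (X n i) (h i) = (if i = j then bop_apply (X n j) y else 0)" for i
        by (simp add: h_def)
      then have "(\<Sum>i<n. bop_apply (X n i) (h i)) = bop_apply (X n j) y" using j by simp
      then have "inner x (\<Sum>i<n. bop_apply (X n i) (h i)) = inner b y"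
        by (simp add: b_def inner_star)
      also have "\<dots> = - (norm b)\<^sup>2 / d" by (simp add: y_def power2_norm_eq_inner)
      finally have "(norm b)\<^sup>2 / d \<le> (norm (bop_apply S x))\<^sup>2"
        using F0[of h x] Fh by (simp add: XS)
      then show "(norm (bop_apply (star (X n j)) x))\<^sup>2 \<le> (sqrt d * norm (bop_apply S x))\<^sup>2"
        using d by (simp add: b_def power_mult_distrib field_simps)
    qed (use d in simp)
    then show ?thesis using bop_factor_through_selfadjoint[OF S, of "sqrt d" "X n j"] d by (metis less_imp_le real_sqrt_ge_0_iff)
  qed
  then obtain G where SG: "\<And>j. j < n \<Longrightarrow> S * G j = X n j"
    and G_in: "\<And>j y. j < n \<Longrightarrow> bop_apply (G j) y \<in> closure (range (bop_apply S))" by metis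
  \<comment> \<open>The Schur complement of the last diagonal entry. The factors \<open>G\<close>
    replace a division by \<open>X n n\<close>, which may fail to be invertible.\<close>
  define Y where "Y i j = X i j - star (G i) * G j" for i j
  have "\<exists>Z. \<forall>i<n. \<forall>j<n. Y i j = (\<Sum>k<n. star (Z k i) * Z k j)"
  proof (rule Suc.IH)
    show "star (Y i j) = Y j i" if "i < n" "j < n" for i j
      using that by (simp add: Y_def star_diff star_mult star_star star_X)
    show "0 \<le> (\<Sum>i<n. \<Sum>j<n. inner (h i) (bop_apply (Y i j) (h j)))" for h
    proof -
      define g where "g = (\<Sum>j<n. bop_apply (G j) (h j))"
      let ?K = "closure (range (bop_apply S))"
      have K: "csubspace ?K"
        by (simp add: csubspace_closure csubspace_range bounded_clinear_bop_apply)
      \<comment> \<open>Completing the square calls for an \<open>x\<close> with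
        \<open>bop_apply S x = - g\<close>, but \<open>- g\<close> is only known to lie in the
        closure of the range. The inequality is therefore proved on the range and carried to the
        closure.\<close>
      have "- g \<in> ?K" unfolding g_def
        by (intro complex_vector.subspace_neg[OF K] complex_vector.subspace_sum[OF K]) (simp add: G_in)
      then have "0 \<le> F h + 2 * inner (- g) g + inner (- g) (- g)"
      proof (rule closure_induct)
        show "closed {w. 0 \<le> F h + 2 * inner w g + inner w w}"
          by (intro closed_Collect_le continuous_intros)
        fix w assume "w \<in> range (bop_apply S)"
        then obtain x where w: "w = bop_apply S x" by blast
        have "bop_apply S g = (\<Sum>j<n. bop_apply (X n j) (h j))"
          unfolding g_def bounded_clinear_sum[OF bounded_clinear_bop_apply]
          by (rule sum.cong) (simp_all flip: bop_apply_times add: SG)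
        then show "0 \<le> F h + 2 * inner w g + inner w w"
          using F0[of h x] by (simp add: w XS power2_norm_eq_inner flip: S_adj)
      qed
      then have "inner g g \<le> F h" by simp
      moreover have "inner g g = (\<Sum>i<n. \<Sum>j<n. inner (h i) (bop_apply (star (G i) * G j) (h j)))"
        by (simp only: g_def inner_sum_left) (simp add: inner_sum_right bop_apply_times inner_star')
      ultimately show ?thesis
        by (simp add: Y_def bop_apply_simps inner_diff_right sum_subtractf F_def)
    qed
  qed
  then obtain Z where Z: "\<And>i j. i < n \<Longrightarrow> j < n \<Longrightarrow> Y i j = (\<Sum>k<n. star (Z k i) * Z k j)" by blast
  \<comment> \<open>The block triangular matrix with rows \<open>(Z, 0)\<close> and
    \<open>(G, S)\<close>: its last row adds back \<open>star (G i) * G j\<close> and produces the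
    last row and column of \<open>X\<close>.\<close>
  define W where "W k j = (if k < n then (if j < n then Z k j else 0) else (if j < n then G j else S))" for k j
  have "X i j = (\<Sum>k<Suc n. star (W k i) * W k j)" if "i < Suc n" "j < Suc n" for i j
  proof -
    consider "i < n" "j < n" | "i < n" "j = n" | "i = n" "j < n" | "i = n" "j = n"
      using \<open>i < Suc n\<close> \<open>j < Suc n\<close> by linarith
    then show ?thesis
    proof cases
      case 1
      then have "X i j = (\<Sum>k<n. star (Z k i) * Z k j) + star (G i) * G j"
        using Z[of i j] by (simp add: Y_def algebra_simps)
      then show ?thesis using 1 by (simp add: W_def)
    next
      case 2
      have "star (G i) * S = star (S * G i)" by (simp add: star_mult S)
      then show ?thesis using 2 by (simp add: W_def SG star_X)
    next
      case 3
      then show ?thesis by (simp add: W_def SG S)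
    next
      case 4
      then show ?thesis by (simp add: W_def SS S)
    qed
  qed
  then show ?case by blast
qed simp

section \<open>From nonnegative forms to positive semidefinite matrices\<close>

lemma mat_star_times_index:
  fixes Y :: "'a::cstar_algebra mat"
  assumes "Y \<in> carrier_mat n n" "i < n" "j < n"
  shows "(mat_star Y * Y) $$ (i, j) = (\<Sum>k<n. star (Y $$ (k, i)) * Y $$ (k, j))"
  using assms by (simp add: mat_star_def scalar_prod_def lessThan_atLeast0)

lemma mat_star_carrier: "Y \<in> carrier_mat n n \<Longrightarrow> mat_star Y \<in> carrier_mat n n"
  by (simp add: mat_star_def)

text \<open>The entries of the image of \<open>mat_star Y * Y\<close> are sums over \<open>k\<close>
  of \<open>\<Phi> (star (Y $$ (k, i)) * Y $$ (k, j))\<close>. For each \<open>k\<close> the form is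
  an instance of \<open>pos\<close> with row \<open>k\<close> of \<open>Y\<close> as
  \<open>a\<close>, and the factorization of operator matrices supplies the witness for
  \<open>mat_psd\<close>. Self-adjointness is assumed separately because \<open>pos\<close> sees
  only the real part of the form.\<close>

lemma completely_positiveI:
  fixes \<Phi> :: "'m::cstar_algebra \<Rightarrow> 'h::complex_hilbert bop"
  assumes lin: "clinear \<Phi>" and real: "\<And>a. star (\<Phi> a) = \<Phi> (star a)"
    and pos: "\<And>n a h. 0 \<le> (\<Sum>i<n::nat. \<Sum>j<n. inner (h i) (bop_apply (\<Phi> (star (a i) * a j)) (h j)))"
  shows "completely_positive \<Phi>"
  unfolding completely_positive_def mat_psd_def
proof (intro conjI lin allI ballI impI)
  fix n and X :: "'m mat" assume "\<exists>Y\<in>carrier_mat n n. X = mat_star Y * Y"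
  then obtain Y where Y: "Y \<in> carrier_mat n n" and X: "X = mat_star Y * Y" by blast
  have \<Phi>_0: "\<Phi> 0 = 0" using lin by (metis clinear_iff complex_vector.scale_zero_left)
  have \<Phi>_sum: "\<Phi> (sum f A) = (\<Sum>k\<in>A. \<Phi> (f k))" for f and A :: "nat set"
    using lin by (induction A rule: infinite_finite_induct) (simp_all add: \<Phi>_0 clinear_iff)
  define R where "R i j = \<Phi> (\<Sum>k<n. star (Y $$ (k, i)) * Y $$ (k, j))" for i j
  obtain Z where Z: "\<And>i j. i < n \<Longrightarrow> j < n \<Longrightarrow> R i j = (\<Sum>k<n. star (Z k i) * Z k j)"
  proof -
    have "\<exists>Z. \<forall>i<n. \<forall>j<n. R i j = (\<Sum>k<n. star (Z k i) * Z k j)"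
    proof (rule operator_matrix_factorization)
      show "star (R i j) = R j i" for i j by (simp add: R_def real star_sum star_mult star_star)
      show "0 \<le> (\<Sum>i<n. \<Sum>j<n. inner (h i) (bop_apply (R i j) (h j)))" for h
      proof -
        have "(\<Sum>i<n. \<Sum>j<n. inner (h i) (bop_apply (R i j) (h j)))
            = (\<Sum>i<n. \<Sum>j<n. \<Sum>k<n. inner (h i) (bop_apply (\<Phi> (star (Y $$ (k, i)) * Y $$ (k, j))) (h j)))"
          by (simp add: R_def \<Phi>_sum bop_apply_sum_left inner_sum_right)
        also have "\<dots> = (\<Sum>i<n. \<Sum>k<n. \<Sum>j<n. inner (h i) (bop_apply (\<Phi> (star (Y $$ (k, i)) * Y $$ (k, j))) (h j)))"
          by (intro sum.cong refl sum.swap)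
        also have "\<dots> = (\<Sum>k<n. \<Sum>i<n. \<Sum>j<n. inner (h i) (bop_apply (\<Phi> (star (Y $$ (k, i)) * Y $$ (k, j))) (h j)))"
          by (rule sum.swap)
        also have "\<dots> \<ge> 0" by (rule sum_nonneg) (rule pos)
        finally show ?thesis .
      qed
    qed
    then show thesis using that by blast
  qed
  define M where "M = mat n n (\<lambda>(k, j). Z k j)"
  have M: "M \<in> carrier_mat n n" by (simp add: M_def)
  have "map_mat \<Phi> X = mat_star M * M"
  proof (rule eq_matI)
    fix i j assume "i < dim_row (mat_star M * M)" "j < dim_col (mat_star M * M)"
    then have ij: "i < n" "j < n" by (simp_all add: M_def mat_star_def)
    have "X \<in> carrier_mat n n" unfolding X by (rule mult_carrier_mat[OF mat_star_carrier[OF Y] Y])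
    then have "map_mat \<Phi> X $$ (i, j) = R i j"
      using ij by (simp add: R_def) (simp add: X mat_star_times_index[OF Y])
    also have "\<dots> = (mat_star M * M) $$ (i, j)"
      unfolding mat_star_times_index[OF M ij] using Z[OF ij] ij by (simp add: M_def)
    finally show "map_mat \<Phi> X $$ (i, j) = (mat_star M * M) $$ (i, j)" .
  qed (use Y in \<open>simp_all add: X M_def mat_star_def\<close>)
  then show "\<exists>Y\<in>carrier_mat n n. map_mat \<Phi> X = mat_star Y * Y" using M by blast
qed

subsection \<open>Extremal decompositions\<close>

lemma norm_unitary_between:
  assumes "unitary_between K L U" "x \<in> K" shows "norm (U x) = norm x"
  using assms by (intro norm_eq_of_cinner_eq) (simp add: unitary_between_def)

lemma star_bop_sum: "star (bop_sum S T) = bop_sum (star S) (star T)"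
  by (rule bop_eqI_cinner, simp only: cinner_star_bop')
    (simp add: cinner_star_bop' cinner_prod_def bop_apply_bop_sum)

lemma fst_scaleC: "fst (c *\<^sub>C z) = c *\<^sub>C fst z" and snd_scaleC: "snd (c *\<^sub>C z) = c *\<^sub>C snd z"
  by (simp_all add: scaleC_prod_def)

text \<open>The multiplier \<open>k c\<close> treats linear and conjugate-linear functions together,
  so that span induction works in either argument of \<open>cinner\<close>.\<close>

lemma csubspace_Collect_eq:
  fixes f g :: "'a::complex_vector \<Rightarrow> complex"
  assumes "\<And>x y. f (x + y) = f x + f y" "\<And>x y. g (x + y) = g x + g y"
    and "\<And>c x. f (c *\<^sub>C x) = k c * f x" "\<And>c x. g (c *\<^sub>C x) = k c * g x"
  shows "csubspace {x. f x = g x}"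
proof (rule complex_vector.subspaceI)
  show "0 \<in> {x. f x = g x}" using assms(1)[of 0 0] assms(2)[of 0 0] by simp
qed (simp_all add: assms)

text \<open>The factorization is assumed only weakly, through inner products, so that the formula
  serves both the given maps and the summand \<open>\<delta>\<close>, whose factorization is not
  shown to be minimal.\<close>

lemma stinespring_form:
  fixes \<pi> :: "('m::cstar_algebra, 'l::complex_hilbert) rep" and V :: "'h::complex_hilbert \<Rightarrow> 'l"
  assumes \<pi>: "representation \<pi>"
    and \<phi>: "\<And>a x y. cinner x (bop_apply (\<phi> a) y) = cinner (V x) (bop_apply (rep_op \<pi> a) (V y))"
  shows "(\<Sum>i<n::nat. \<Sum>j<n. inner (h i) (bop_apply (\<phi> (star (a i) * a j)) (h j)))
    = (norm (\<Sum>j<n. bop_apply (rep_op \<pi> (a j)) (V (h j))))\<^sup>2"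
proof -
  have "inner (h i) (bop_apply (\<phi> (star (a i) * a j)) (h j))
      = inner (bop_apply (rep_op \<pi> (a i)) (V (h i))) (bop_apply (rep_op \<pi> (a j)) (V (h j)))" for i j
    by (simp add: \<phi> cinner_rep[OF \<pi>] rep_mult[OF \<pi>] flip: Re_cinner)
  then show ?thesis
    by (simp only: power2_norm_eq_inner inner_sum_left) (simp only: inner_sum_right)
qed

lemma stinespring_star:
  fixes \<pi> :: "('m::cstar_algebra, 'l::complex_hilbert) rep" and V :: "'h::complex_hilbert \<Rightarrow> 'l"
  assumes \<pi>: "representation \<pi>"
    and \<phi>: "\<And>a x y. cinner x (bop_apply (\<phi> a) y) = cinner (V x) (bop_apply (rep_op \<pi> a) (V y))"
  shows "star (\<phi> a) = \<phi> (star a)"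
proof (rule bop_eqI_cinner)
  fix x y
  have "cinner x (bop_apply (star (\<phi> a)) y) = cnj (cinner y (bop_apply (\<phi> a) x))"
    by (metis cinner_star_bop' cinner_commute)
  also have "\<dots> = cinner (bop_apply (rep_op \<pi> a) (V x)) (V y)" by (metis \<phi> cinner_commute)
  finally show "cinner x (bop_apply (star (\<phi> a)) y) = cinner x (bop_apply (\<phi> (star a)) y)"
    by (simp add: \<phi> cinner_rep[OF \<pi>])
qed

lemma cinner_minimal_stinespring:
  assumes "minimal_stinespring \<phi> \<pi> V"
  shows "cinner x (bop_apply (\<phi> a) y) = cinner (V x) (bop_apply (rep_op \<pi> a) (V y))"
  using assms by (simp add: minimal_stinespring_def cinner_cadjoint')

lemma supp_subset_of_extremal:
  fixes \<phi> \<phi>\<^sub>p \<phi>\<^sub>m \<psi>\<^sub>p \<psi>\<^sub>m :: "'m::cstar_algebra \<Rightarrow> 'h::complex_hilbert bop"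
    and \<pi>\<^sub>p :: "('m, 'l1::complex_hilbert) rep" and V\<^sub>p :: "'h \<Rightarrow> 'l1"
    and \<pi>\<^sub>m :: "('m, 'l2::complex_hilbert) rep" and V\<^sub>m :: "'h \<Rightarrow> 'l2"
    and \<rho>\<^sub>p :: "('m, 'l3::complex_hilbert) rep" and W\<^sub>p :: "'h \<Rightarrow> 'l3"
    and \<rho>\<^sub>m :: "('m, 'l4::complex_hilbert) rep" and W\<^sub>m :: "'h \<Rightarrow> 'l4"
  assumes ext: "extremal_wittstock_decomposition \<phi> \<phi>\<^sub>p \<phi>\<^sub>m"
    and dec: "wittstock_decomposition \<phi> \<psi>\<^sub>p \<psi>\<^sub>m"
    and st: "minimal_stinespring \<phi>\<^sub>p \<pi>\<^sub>p V\<^sub>p" "minimal_stinespring \<phi>\<^sub>m \<pi>\<^sub>m V\<^sub>m"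
      "minimal_stinespring \<psi>\<^sub>p \<rho>\<^sub>p W\<^sub>p" "minimal_stinespring \<psi>\<^sub>m \<rho>\<^sub>m W\<^sub>m"
  shows "supp_subset \<pi>\<^sub>p \<rho>\<^sub>p"
  unfolding supp_subset_def
proof
  assume "\<exists>\<sigma> :: ('m, 'l1) rep. subrepresentation \<sigma> \<pi>\<^sub>p \<and> rep_space \<sigma> \<noteq> {0} \<and> totally_orthogonal \<sigma> \<rho>\<^sub>p"
  then obtain \<sigma> :: "('m, 'l1) rep" where sub: "subrepresentation \<sigma> \<pi>\<^sub>p"
    and nonzero: "rep_space \<sigma> \<noteq> {0}" and orth: "totally_orthogonal \<sigma> \<rho>\<^sub>p" by blast
  have \<sigma>: "representation \<sigma>" and \<pi>\<^sub>p: "representation \<pi>\<^sub>p"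
    using sub by (simp_all add: subrepresentation_def)
  have \<pi>\<^sub>m: "representation \<pi>\<^sub>m" and \<rho>\<^sub>p: "representation \<rho>\<^sub>p" and \<rho>\<^sub>m: "representation \<rho>\<^sub>m"
    using st by (simp_all add: minimal_stinespring_def)
  note Lp = rep_csubspace[OF \<pi>\<^sub>p] rep_closed[OF \<pi>\<^sub>p]
  note form = st[THEN cinner_minimal_stinespring]
  have V\<^sub>p: "bounded_clinear V\<^sub>p" using st(1) by (simp add: minimal_stinespring_def)
  have sums: "\<phi>\<^sub>p c + \<psi>\<^sub>m c = \<psi>\<^sub>p c + \<phi>\<^sub>m c" for c
  proof -
    have "\<phi>\<^sub>p c - \<phi>\<^sub>m c = \<phi> c"
      using ext by (simp add: extremal_wittstock_decomposition_def wittstock_decomposition_def)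
    moreover have "\<psi>\<^sub>p c - \<psi>\<^sub>m c = \<phi> c" using dec by (simp add: wittstock_decomposition_def)
    moreover have "\<phi>\<^sub>p c + \<psi>\<^sub>m c = (\<phi>\<^sub>p c - \<phi>\<^sub>m c) + (\<phi>\<^sub>m c + \<psi>\<^sub>m c)" by simp
    moreover have "\<psi>\<^sub>p c + \<phi>\<^sub>m c = (\<psi>\<^sub>p c - \<psi>\<^sub>m c) + (\<phi>\<^sub>m c + \<psi>\<^sub>m c)" by simp
    ultimately show ?thesis by (simp only:)
  qed
  obtain \<tau> :: "('m, 'l1) rep" and U where \<tau>: "representation \<tau>"
    and U: "unitary_between (rep_space \<pi>\<^sub>p) (rep_space \<sigma> \<times> rep_space \<tau>) U"
    and U_op: "\<And>a x. x \<in> rep_space \<pi>\<^sub>p \<Longrightarrow> U (bop_apply (rep_op \<pi>\<^sub>p a) x) =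
      (bop_apply (rep_op \<sigma> a) (fst (U x)), bop_apply (rep_op \<tau> a) (snd (U x)))"
    using sub by (auto simp: subrepresentation_def rep_equivalent_def rep_sum_def bop_apply_bop_sum)

  \<comment> \<open>The coordinate projection of \<open>\<pi>\<^sub>p\<close> onto its summand
    \<open>\<sigma>\<close>, read through \<open>U\<close>. Projecting to the space of
    \<open>\<pi>\<^sub>p\<close> beforehand makes it a contraction on the whole type.\<close>
  define Q where "Q x = fst (U (bop_apply (proj (rep_space \<pi>\<^sub>p)) x))" for x
  have Q_le: "norm (Q x) \<le> norm x" for x
  proof -
    have "norm (Q x) \<le> norm (U (bop_apply (proj (rep_space \<pi>\<^sub>p)) x))"
      unfolding Q_def by (metis norm_fst_le prod.collapse)
    also have "\<dots> \<le> norm x"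
      by (simp add: norm_unitary_between[OF U] proj_in[OF Lp] norm_proj_le[OF Lp])
    finally show ?thesis .
  qed
  have Q: "bounded_clinear Q"
    by (rule bounded_clinearI[where K = 1])
      (use U proj_in[OF Lp] Q_le in \<open>simp_all add: Q_def unitary_between_def bop_apply_add bop_apply_scaleC scaleC_prod_def\<close>)
  have Q_op: "Q (bop_apply (rep_op \<pi>\<^sub>p a) x) = bop_apply (rep_op \<sigma> a) (Q x)" for a x
    using U_op[OF proj_in[OF Lp]]
    by (simp add: Q_def proj_ident[OF Lp] rep_in[OF \<pi>\<^sub>p] rep_proj[OF \<pi>\<^sub>p])
  have Q_in: "Q x \<in> rep_space \<sigma>" for x
    using U proj_in[OF Lp, of x] unfolding Q_def unitary_between_def by (metis image_eqI mem_Times_iff)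
  have Q_onto: "\<exists>x\<in>rep_space \<pi>\<^sub>p. Q x = s" if "s \<in> rep_space \<sigma>" for s
  proof -
    have "(s, 0) \<in> U ` rep_space \<pi>\<^sub>p"
      using U that complex_vector.subspace_0[OF rep_csubspace[OF \<tau>]] by (simp add: unitary_between_def)
    then obtain x where "x \<in> rep_space \<pi>\<^sub>p" "U x = (s, 0)" by force
    then show ?thesis by (intro bexI[of _ x]) (simp_all add: Q_def proj_ident[OF Lp])
  qed

  \<comment> \<open>Compressing the Stinespring factorization of \<open>\<phi>\<^sub>p\<close> to
    the summand: \<open>\<delta> a\<close> is the operator
    \<open>A\<^sup>* \<sigma>(a) A\<close>.\<close>
  define A where "A x = Q (V\<^sub>p x)" for x
  have A: "bounded_clinear A" unfolding A_def by (rule bounded_clinear_compose[OF Q V\<^sub>p])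
  have "\<exists>T. \<forall>x y. cinner x (bop_apply T y) = cinner (A x) (bop_apply (rep_op \<sigma> a) (A y))" for a
  proof -
    obtain T where "bop_apply T = (\<lambda>y. cadjoint A (bop_apply (rep_op \<sigma> a) (A y)))"
      by (rule bop_of_bounded_clinear[OF bounded_clinear_compose[OF bounded_clinear_cadjoint[OF A]
        bounded_clinear_compose[OF bounded_clinear_bop_apply A]]])
    then show ?thesis by (intro exI[of _ T]) (simp add: cinner_cadjoint'[OF A])
  qed
  then obtain \<delta> where \<delta>: "\<And>a x y. cinner x (bop_apply (\<delta> a) y) = cinner (A x) (bop_apply (rep_op \<sigma> a) (A y))"
    by metis
  have \<delta>_lin: "clinear \<delta>"
    using rep_clinear[OF \<sigma>] unfolding clinear_iff
    by (auto intro!: bop_eqI_cinner simp: bop_apply_simps bop_apply_scaleC_left cinner_add_right cinner_scaleC_right \<delta>)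
  note \<delta>_star = stinespring_star[OF \<sigma> \<delta>] and \<delta>_form = stinespring_form[OF \<sigma> \<delta>]

  \<comment> \<open>The components follow the identity \<open>\<phi>\<^sub>p + \<psi>\<^sub>m =
    \<psi>\<^sub>p + \<phi>\<^sub>m\<close>: the first two belong to its left side, the last two to
    its right side. Working with tuples in one span \<open>Z\<close> keeps the four sums attached to
    the same coefficients.\<close>
  define act :: "'m \<Rightarrow> ('l1 \<times> 'l4 \<times> 'l3 \<times> 'l2) bop"
    where "act a = bop_sum (rep_op \<pi>\<^sub>p a) (bop_sum (rep_op \<rho>\<^sub>m a) (bop_sum (rep_op \<rho>\<^sub>p a) (rep_op \<pi>\<^sub>m a)))" for a
  define gen where "gen a h = bop_apply (act a) (V\<^sub>p h, W\<^sub>m h, W\<^sub>p h, V\<^sub>m h)" for a h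
  define Z where "Z = cspan {gen a h | a h. True}"
  have act_apply: "bop_apply (act a) (z1, z2, z3, z4) = (bop_apply (rep_op \<pi>\<^sub>p a) z1,
      bop_apply (rep_op \<rho>\<^sub>m a) z2, bop_apply (rep_op \<rho>\<^sub>p a) z3, bop_apply (rep_op \<pi>\<^sub>m a) z4)" for a z1 z2 z3 z4
    by (simp add: act_def bop_apply_bop_sum)
  have gen_in: "gen a h \<in> Z" for a h unfolding Z_def by (rule complex_vector.span_base) blast
  have Z: "csubspace Z" unfolding Z_def by (rule complex_vector.subspace_span)
  have Z_induct: "P z" if "z \<in> Z" "csubspace (Collect P)" "\<And>a h. P (gen a h)" for P z
    by (rule complex_vector.span_induct[OF that(1)[unfolded Z_def]]) (use that in auto)

  \<comment> \<open>Both sides are sesquilinear, so generators suffice. There the claim is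
    \<open>sums\<close> at \<open>star a * b\<close>, paired with \<open>h\<close> and
    \<open>k\<close>.\<close>
  have Z_cinner: "cinner (fst z) (fst w) + cinner (fst (snd z)) (fst (snd w))
      = cinner (snd (snd z)) (snd (snd w))" if z: "z \<in> Z" and w: "w \<in> Z" for z w
    using w
  proof (rule Z_induct)
    show "csubspace {w. cinner (fst z) (fst w) + cinner (fst (snd z)) (fst (snd w))
        = cinner (snd (snd z)) (snd (snd w))}"
      by (rule csubspace_Collect_eq[where k = "\<lambda>c. c"])
        (simp_all only: fst_add snd_add fst_scaleC snd_scaleC cinner_add_right cinner_scaleC_right
          distrib_left add_ac)
    fix b k
    show "cinner (fst z) (fst (gen b k)) + cinner (fst (snd z)) (fst (snd (gen b k)))
        = cinner (snd (snd z)) (snd (snd (gen b k)))"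
      using z
    proof (rule Z_induct)
      show "csubspace {z. cinner (fst z) (fst (gen b k)) + cinner (fst (snd z)) (fst (snd (gen b k)))
          = cinner (snd (snd z)) (snd (snd (gen b k)))}"
        by (rule csubspace_Collect_eq[where k = cnj])
          (simp_all only: fst_add snd_add fst_scaleC snd_scaleC cinner_add_left cinner_scaleC_left
            distrib_left add_ac)
      fix a h
      note sums[of "star a * b"]
      then have "cinner h (bop_apply (\<phi>\<^sub>p (star a * b)) k) + cinner h (bop_apply (\<psi>\<^sub>m (star a * b)) k)
          = cinner h (bop_apply (\<psi>\<^sub>p (star a * b)) k) + cinner h (bop_apply (\<phi>\<^sub>m (star a * b)) k)"
        by (simp flip: cinner_add_right bop_apply_simps)
      then show "cinner (fst (gen a h)) (fst (gen b k)) + cinner (fst (snd (gen a h))) (fst (snd (gen b k)))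
          = cinner (snd (snd (gen a h))) (snd (snd (gen b k)))"
        unfolding form rep_mult[OF \<pi>\<^sub>p] rep_mult[OF \<pi>\<^sub>m] rep_mult[OF \<rho>\<^sub>p] rep_mult[OF \<rho>\<^sub>m]
        by (simp add: gen_def act_apply cinner_prod_def cinner_rep[OF \<pi>\<^sub>p] cinner_rep[OF \<pi>\<^sub>m]
            cinner_rep[OF \<rho>\<^sub>p] cinner_rep[OF \<rho>\<^sub>m])
    qed
  qed
  \<comment> \<open>Discarding the \<open>\<rho>\<^sub>m\<close> component from the norm identity
    expresses \<open>\<phi>\<^sub>p \<le> \<psi>\<^sub>p + \<phi>\<^sub>m\<close>.\<close>
  have Z_norm: "norm (fst z) \<le> norm (snd (snd z))" if "z \<in> Z" for z
  proof (rule power2_le_imp_le)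
    have "(norm (fst z))\<^sup>2 + (norm (fst (snd z)))\<^sup>2 = (norm (snd (snd z)))\<^sup>2"
      using arg_cong[OF Z_cinner[OF that that], of Re] by (simp add: cinner_self)
    then show "(norm (fst z))\<^sup>2 \<le> (norm (snd (snd z)))\<^sup>2"
      using zero_le_power2[of "norm (fst (snd z))"] by linarith
  qed simp

  have Z_act: "bop_apply (act a) z \<in> Z" if "z \<in> Z" for a z
    using that
  proof (rule Z_induct)
    show "csubspace {z. bop_apply (act a) z \<in> Z}"
      by (rule complex_vector.subspaceI)
        (simp_all add: bop_apply_add bop_apply_scaleC complex_vector.subspace_0[OF Z]
          complex_vector.subspace_add[OF Z] complex_vector.subspace_scale[OF Z])
    have "bop_apply (act a) (gen b h) = gen (a * b) h" for b h
      by (simp add: gen_def act_apply rep_mult[OF \<pi>\<^sub>p] rep_mult[OF \<pi>\<^sub>m] rep_mult[OF \<rho>\<^sub>p] rep_mult[OF \<rho>\<^sub>m])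
    then show "bop_apply (act a) (gen b h) \<in> Z" for b h by (simp add: gen_in)
  qed
  have Z_in: "fst (snd (snd z)) \<in> rep_space \<rho>\<^sub>p" if "z \<in> Z" for z
    using that
  proof (rule Z_induct)
    show "csubspace {z. fst (snd (snd z)) \<in> rep_space \<rho>\<^sub>p}"
      by (rule complex_vector.subspaceI)
        (simp_all add: scaleC_prod_def complex_vector.subspace_0[OF rep_csubspace[OF \<rho>\<^sub>p]]
          complex_vector.subspace_add[OF rep_csubspace[OF \<rho>\<^sub>p]]
          complex_vector.subspace_scale[OF rep_csubspace[OF \<rho>\<^sub>p]])
  qed (simp add: gen_def act_apply rep_in[OF \<rho>\<^sub>p])

  \<comment> \<open>The graph of the map from the \<open>\<rho>\<^sub>p\<close> and
    \<open>\<pi>\<^sub>m\<close> components to the \<open>\<sigma>\<close> part of the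
    \<open>\<pi>\<^sub>p\<close> component. It is contractive by \<open>Z_norm\<close>, and
    \<open>C\<close> is its extension.\<close>
  define G where "G = (\<lambda>z. (snd (snd z), Q (fst z))) ` Z"
  have G: "csubspace G" unfolding G_def
    by (intro csubspace_image Z bounded_clinear_Pair bounded_clinear_compose[OF Q bounded_clinear_fst]
        bounded_clinear_compose[OF bounded_clinear_snd bounded_clinear_snd])
  have G_le: "norm y \<le> 1 * norm x" if "(x, y) \<in> G" for x y
    using that unfolding G_def by (auto intro: order_trans[OF Q_le Z_norm])
  let ?K = "closure (fst ` G)"
  have K: "csubspace ?K" "closed ?K"
    by (intro csubspace_closure csubspace_image bounded_clinear_fst G closed_closure)+
  obtain C where C: "bounded_clinear C" and CG: "\<And>x y. (x, y) \<in> G \<Longrightarrow> C x = y"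
    and C_cl: "\<And>x. C x \<in> closure (snd ` G)" and C_proj: "\<And>x. C (bop_apply (proj ?K) x) = C x"
    and C_le: "\<And>x. norm (C x) \<le> 1 * norm x"
    by (rule bounded_graph_extension[OF G zero_le_one G_le]) blast+
  have CZ: "C (snd (snd z)) = Q (fst z)" if "z \<in> Z" for z
    by (rule CG) (use that in \<open>auto simp: G_def\<close>)
  have C_in: "C x \<in> rep_space \<sigma>" for x
  proof -
    have "snd ` G \<subseteq> rep_space \<sigma>" using Q_in by (auto simp: G_def)
    from closure_minimal[OF this rep_closed[OF \<sigma>]] show ?thesis using C_cl[of x] by (rule subsetD)
  qed
  define R where "R a = bop_sum (rep_op \<rho>\<^sub>p a) (rep_op \<pi>\<^sub>m a)" for a
  have R_act: "bop_apply (R a) (snd (snd z)) = snd (snd (bop_apply (act a) z))" for a z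
    by (simp add: R_def act_def bop_apply_bop_sum)
  have fst_G: "fst ` G = (\<lambda>z. snd (snd z)) ` Z" by (simp add: G_def image_image)
  have R_K: "bop_apply (R a) x \<in> ?K" if "x \<in> ?K" for a x
    using that
  proof (rule closure_image_mem[OF _ continuous_bop_apply])
    fix x assume "x \<in> fst ` G"
    then obtain z where z: "z \<in> Z" and x: "x = snd (snd z)" unfolding fst_G by blast
    show "bop_apply (R a) x \<in> fst ` G"
      unfolding x R_act fst_G using imageI[OF Z_act[OF z], of "\<lambda>z. snd (snd z)"] .
  qed
  have C_K: "C (bop_apply (R a) x) = bop_apply (rep_op \<sigma> a) (C x)" if "x \<in> ?K" for a x
    using that
  proof (rule closure_induct)
    show "closed {x. C (bop_apply (R a) x) = bop_apply (rep_op \<sigma> a) (C x)}"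
      by (intro closed_Collect_eq continuous_bounded_clinear bounded_clinear_compose[OF C]
          bounded_clinear_compose[OF bounded_clinear_bop_apply C] bounded_clinear_bop_apply)
    fix x assume "x \<in> fst ` G"
    then obtain z where z: "z \<in> Z" and x: "x = snd (snd z)" unfolding fst_G by blast
    have "C (bop_apply (R a) x) = Q (fst (bop_apply (act a) z))"
      unfolding x R_act by (rule CZ[OF Z_act[OF z]])
    also have "fst (bop_apply (act a) z) = bop_apply (rep_op \<pi>\<^sub>p a) (fst z)"
      by (simp add: act_def bop_apply_bop_sum)
    finally show "C (bop_apply (R a) x) = bop_apply (rep_op \<sigma> a) (C x)"
      by (simp add: Q_op x CZ[OF z])
  qed
  \<comment> \<open>On \<open>?K\<close> the intertwining relation holds by density. Since
    \<open>R\<close> respects \<open>star\<close>, the projection onto \<open>?K\<close> commutes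
    with it, and \<open>C\<close> ignores the complement of \<open>?K\<close>; hence the relation
    holds everywhere.\<close>
  have C_R: "C (bop_apply (R a) x) = bop_apply (rep_op \<sigma> a) (C x)" for a x
  proof -
    have "star (R a) = R (star a)"
      by (simp add: R_def star_bop_sum rep_star[OF \<rho>\<^sub>p] rep_star[OF \<pi>\<^sub>m])
    then have "bop_apply (proj ?K) (bop_apply (R a) x) = bop_apply (R a) (bop_apply (proj ?K) x)"
      by (intro proj_commute[OF K]) (simp_all add: R_K)
    then have "C (bop_apply (R a) x) = C (bop_apply (R a) (bop_apply (proj ?K) x))"
      using C_proj[of "bop_apply (R a) x"] by simp
    then show ?thesis by (simp add: C_K proj_in[OF K] C_proj)
  qed

  have C_zero: "C (x, 0) = 0" if "x \<in> rep_space \<rho>\<^sub>p" for x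
  proof -
    note L = rep_csubspace[OF \<rho>\<^sub>p] rep_closed[OF \<rho>\<^sub>p]
    \<comment> \<open>The restriction of \<open>C\<close> to the first summand, extended by zero off
      the space of \<open>\<rho>\<^sub>p\<close>, as required of an intertwiner to which total
      orthogonality is applied.\<close>
    define D where "D x = C (bop_apply (proj (rep_space \<rho>\<^sub>p)) x, 0)" for x
    have "D x = 0"
    proof (rule totally_orthogonal_intertwiner_eq_zero[OF \<sigma> \<rho>\<^sub>p _ _ _ _ orth])
      show "bounded_clinear D" unfolding D_def
        by (intro bounded_clinear_compose[OF C] bounded_clinear_Pair bounded_clinear_bop_apply bounded_clinear_zero_fun)
      show "D (bop_apply (rep_op \<rho>\<^sub>p a) x) = bop_apply (rep_op \<sigma> a) (D x)" for a x
        using C_R[of a "(bop_apply (proj (rep_space \<rho>\<^sub>p)) x, 0)"]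
        by (simp add: D_def R_def bop_apply_bop_sum rep_proj[OF \<rho>\<^sub>p] proj_ident[OF L] rep_in[OF \<rho>\<^sub>p])
    qed (simp_all add: D_def C_in proj_proj[OF L])
    then show ?thesis by (simp add: D_def proj_ident[OF L that])
  qed
  \<comment> \<open>Once \<open>C\<close> is known to vanish on \<open>\<rho>\<^sub>p\<close>, only
    the \<open>\<pi>\<^sub>m\<close> component contributes. This inequality is
    \<open>\<delta> \<le> \<phi>\<^sub>m\<close> in terms of vectors.\<close>
  have Q_Z: "norm (Q (fst z)) \<le> norm (snd (snd (snd z)))" if "z \<in> Z" for z
  proof -
    have "Q (fst z) = C ((fst (snd (snd z)), 0) + (0, snd (snd (snd z))))"
      by (simp flip: CZ[OF that])
    also have "\<dots> = C (0, snd (snd (snd z)))"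
      unfolding bounded_clinear_add[OF C] by (simp add: C_zero Z_in that)
    finally show ?thesis using C_le[of "(0, snd (snd (snd z)))"] by (simp add: norm_prod_def)
  qed

  \<comment> \<open>For \<open>z\<close> the sum of the generators, the three forms are the squared
    norms of \<open>Q (fst z)\<close>, of \<open>fst z\<close> and of the
    \<open>\<pi>\<^sub>m\<close> component. The first bound is the contractivity of
    \<open>Q\<close>, the second is \<open>Q_Z\<close>.\<close>
  have \<delta>_le: "(\<Sum>i<n::nat. \<Sum>j<n. inner (h i) (bop_apply (\<delta> (star (a i) * a j)) (h j)))
        \<le> (\<Sum>i<n. \<Sum>j<n. inner (h i) (bop_apply (\<phi>\<^sub>p (star (a i) * a j)) (h j)))" (is "?d \<le> ?p")
    and \<delta>_le': "(\<Sum>i<n::nat. \<Sum>j<n. inner (h i) (bop_apply (\<delta> (star (a i) * a j)) (h j)))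
        \<le> (\<Sum>i<n. \<Sum>j<n. inner (h i) (bop_apply (\<phi>\<^sub>m (star (a i) * a j)) (h j)))" (is "_ \<le> ?m")
    for n a h
  proof -
    define z where "z = (\<Sum>j<n. gen (a j) (h j))"
    have z: "z \<in> Z" unfolding z_def by (intro complex_vector.subspace_sum[OF Z] gen_in)
    have fst_z: "fst z = (\<Sum>j<n. bop_apply (rep_op \<pi>\<^sub>p (a j)) (V\<^sub>p (h j)))"
      and snd_z: "snd (snd (snd z)) = (\<Sum>j<n. bop_apply (rep_op \<pi>\<^sub>m (a j)) (V\<^sub>m (h j)))"
      by (simp_all add: z_def fst_sum snd_sum gen_def act_apply)
    have d: "?d = (norm (Q (fst z)))\<^sup>2"
      unfolding \<delta>_form fst_z bounded_clinear_sum[OF Q] by (simp add: Q_op A_def)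
    have p: "?p = (norm (fst z))\<^sup>2" unfolding fst_z by (rule stinespring_form[OF \<pi>\<^sub>p form(1)])
    have m: "?m = (norm (snd (snd (snd z))))\<^sup>2"
      unfolding snd_z by (rule stinespring_form[OF \<pi>\<^sub>m form(2)])
    show "?d \<le> ?p" unfolding d p by (intro power_mono Q_le) simp
    show "?d \<le> ?m" unfolding d m by (intro power_mono Q_Z z) simp
  qed

  have cp_diff: "completely_positive (\<lambda>a. \<Phi> a - \<delta> a)"
    if "completely_positive \<Phi>" "\<And>a. star (\<Phi> a) = \<Phi> (star a)"
      and le: "\<And>n a h. (\<Sum>i<n::nat. \<Sum>j<n. inner (h i) (bop_apply (\<delta> (star (a i) * a j)) (h j)))
        \<le> (\<Sum>i<n. \<Sum>j<n. inner (h i) (bop_apply (\<Phi> (star (a i) * a j)) (h j)))" for \<Phi>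
  proof (rule completely_positiveI)
    show "clinear (\<lambda>a. \<Phi> a - \<delta> a)"
      using that(1) \<delta>_lin by (simp add: completely_positive_def clinear_iff scaleC_diff_right)
    show "star (\<Phi> a - \<delta> a) = \<Phi> (star a) - \<delta> (star a)" for a by (simp add: star_diff that(2) \<delta>_star)
    show "0 \<le> (\<Sum>i<n::nat. \<Sum>j<n. inner (h i) (bop_apply (\<Phi> (star (a i) * a j) - \<delta> (star (a i) * a j)) (h j)))" for n a h
      using le[of h a n] by (simp add: bop_apply_simps inner_diff_right sum_subtractf)
  qed
  have cp: "completely_positive \<phi>\<^sub>p" "completely_positive \<phi>\<^sub>m"
    using ext by (simp_all add: extremal_wittstock_decomposition_def wittstock_decomposition_def)
  have "completely_positive \<delta>"
    by (rule completely_positiveI[OF \<delta>_lin \<delta>_star]) (simp add: \<delta>_form)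
  moreover have "completely_positive (\<lambda>a. \<phi>\<^sub>p a - \<delta> a)"
    by (rule cp_diff[OF cp(1) stinespring_star[OF \<pi>\<^sub>p form(1)] \<delta>_le])
  moreover have "completely_positive (\<lambda>a. \<phi>\<^sub>m a - \<delta> a)"
    by (rule cp_diff[OF cp(2) stinespring_star[OF \<pi>\<^sub>m form(2)] \<delta>_le'])
  \<comment> \<open>If \<open>\<delta>\<close> vanished, its values at \<open>star a * a\<close>
    would give \<open>Q (bop_apply (rep_op \<pi>\<^sub>p a) (V\<^sub>p h)) = 0\<close>. By
    minimality these vectors span a dense subspace, so \<open>Q\<close> would vanish on the space of
    \<open>\<pi>\<^sub>p\<close>, although it maps that space onto the nonzero space of
    \<open>\<sigma>\<close>.\<close>
  moreover have "\<delta> \<noteq> (\<lambda>a. 0)"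
  proof
    assume \<delta>_0: "\<delta> = (\<lambda>a. 0)"
    have Q_gen: "Q (bop_apply (rep_op \<pi>\<^sub>p a) (V\<^sub>p h)) = 0" for a h
    proof -
      have "cinner (bop_apply (rep_op \<sigma> a) (A h)) (bop_apply (rep_op \<sigma> a) (A h)) = 0"
        using \<delta>[of h "star a * a" h] by (simp add: \<delta>_0 bop_apply_simps cinner_rep[OF \<sigma>] rep_mult[OF \<sigma>])
      then show ?thesis by (simp add: Q_op A_def cinner_self)
    qed
    have "Q x = 0" if "x \<in> rep_space \<pi>\<^sub>p" for x
    proof -
      have "x \<in> closure (cspan {bop_apply (rep_op \<pi>\<^sub>p a) (V\<^sub>p h) | a h. True})"
        using that st(1) by (simp add: minimal_stinespring_def)
      then show ?thesis
      proof (rule closure_induct)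
        show "closed {x. Q x = 0}"
          by (intro closed_Collect_eq continuous_bounded_clinear Q continuous_on_const)
        show "Q x = 0" if "x \<in> cspan {bop_apply (rep_op \<pi>\<^sub>p a) (V\<^sub>p h) | a h. True}" for x
          using that
        proof (rule complex_vector.span_induct)
          show "csubspace {x. Q x = 0}"
            by (rule complex_vector.subspaceI)
              (simp_all add: bounded_clinear_zero[OF Q] bounded_clinear_add[OF Q] bounded_clinear_scaleC[OF Q])
        qed (auto simp: Q_gen)
      qed
    qed
    then have "rep_space \<sigma> \<subseteq> {0}" using Q_onto by fastforce
    then have "rep_space \<sigma> = {0}"
      using complex_vector.subspace_0[OF rep_csubspace[OF \<sigma>]] by blast
    then show False using nonzero by contradiction
  qed
  ultimately show False using ext unfolding extremal_wittstock_decomposition_def by blast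
qed

text \<open>Extremality treats the two summands symmetrically, so a change of sign merely exchanges
  them and turns a statement about plus parts into one about minus parts.\<close>

lemma extremal_wittstock_decomposition_uminus:
  assumes "extremal_wittstock_decomposition \<phi> \<phi>\<^sub>p \<phi>\<^sub>m"
  shows "extremal_wittstock_decomposition (\<lambda>a. - \<phi> a) \<phi>\<^sub>m \<phi>\<^sub>p"
  using assms unfolding extremal_wittstock_decomposition_def wittstock_decomposition_def by auto

theorem theorem2p2:
  fixes \<phi> \<phi>\<^sub>p \<phi>\<^sub>m \<psi>\<^sub>p \<psi>\<^sub>m :: "'m::cstar_algebra \<Rightarrow> 'h::complex_hilbert bop"
    and \<pi>\<^sub>p :: "('m, 'l1::complex_hilbert) rep" and V\<^sub>p :: "'h \<Rightarrow> 'l1"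
    and \<pi>\<^sub>m :: "('m, 'l2::complex_hilbert) rep" and V\<^sub>m :: "'h \<Rightarrow> 'l2"
    and \<rho>\<^sub>p :: "('m, 'l3::complex_hilbert) rep" and W\<^sub>p :: "'h \<Rightarrow> 'l3"
    and \<rho>\<^sub>m :: "('m, 'l4::complex_hilbert) rep" and W\<^sub>m :: "'h \<Rightarrow> 'l4"
  assumes "completely_bounded \<phi>" and "real_map \<phi>"
    and "extremal_wittstock_decomposition \<phi> \<phi>\<^sub>p \<phi>\<^sub>m"
    and "extremal_wittstock_decomposition \<phi> \<psi>\<^sub>p \<psi>\<^sub>m"
    and "minimal_stinespring \<phi>\<^sub>p \<pi>\<^sub>p V\<^sub>p" and "minimal_stinespring \<phi>\<^sub>m \<pi>\<^sub>m V\<^sub>m"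
    and "minimal_stinespring \<psi>\<^sub>p \<rho>\<^sub>p W\<^sub>p" and "minimal_stinespring \<psi>\<^sub>m \<rho>\<^sub>m W\<^sub>m"
  shows "supp_eq \<pi>\<^sub>p \<rho>\<^sub>p \<and> supp_eq \<pi>\<^sub>m \<rho>\<^sub>m"
proof -
  note \<phi> = assms(3) and \<psi> = assms(4)
  note \<phi>' = extremal_wittstock_decomposition_uminus[OF \<phi>]
    and \<psi>' = extremal_wittstock_decomposition_uminus[OF \<psi>]
  note dec = \<phi>[unfolded extremal_wittstock_decomposition_def, THEN conjunct1]
    \<psi>[unfolded extremal_wittstock_decomposition_def, THEN conjunct1]
    \<phi>'[unfolded extremal_wittstock_decomposition_def, THEN conjunct1]
    \<psi>'[unfolded extremal_wittstock_decomposition_def, THEN conjunct1]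
  show ?thesis
    unfolding supp_eq_def
    using supp_subset_of_extremal[OF \<phi> dec(2) assms(5-8)]
      supp_subset_of_extremal[OF \<psi> dec(1) assms(7,8,5,6)]
      supp_subset_of_extremal[OF \<phi>' dec(4) assms(6,5,8,7)]
      supp_subset_of_extremal[OF \<psi>' dec(3) assms(8,7,6,5)]
    by blast
qed

end
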